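(* Let $m,n,r,d$ be integers with $m,n\ge2$, $d\ge1$ and $0<r<\min\{m,n\}$. For each integer $a$ with $0\le a\le rd$ let $d_R=\lfloor a/r\rfloor$, $t_R=a \bmod r$, and define $$\mathcal{A}_a=\Big\{L(\lambda)R(\lambda): L\in\mathbb{C}[\lambda]^{m\times r},\ R\in\mathbb{C}[\lambda]^{r\times n},\ \deg(L_{*i})+\deg(R_{i*})=d\ (i=1,\dots,r),\ \textstyle\sum_{i=1}^r\deg(R_{i*})=a\Big\},$$ $$\mathcal{B}_a=\Big\{L(\lambda)R(\lambda): L\in\mathbb{C}[\lambda]^{m\times r},\ R\in\mathbb{C}[\lambda]^{r\times n},\ \deg(R_{i*})=d_R+1\ (1\le i\le t_R),\ \deg(R_{i*})=d_R\ (t_R<i\le r),\ \deg(L_{*i})=d-\deg(R_{i*})\ (1\le i\le r)\Big\}.$$ Then: (i) $\mathcal{B}_a\subseteq\mathcal{A}_a$ for $a=0,1,\dots,rd$; (ii) $\overline{\mathcal{B}_a}=\overline{\mathcal{A}_a}$ for $a=0,1,\dots,rd$; (iii) $\mathbb{C}[\lambda]^{m\times n}_{d,r}=\bigcup_{0\le a\le rd}\overline{\mathcal{B}_a}$; (iv) for every $P(\lambda)\in\mathbb{C}[\lambda]^{m\times n}_{d,r}$ there exists an integer $a$ with $P(\lambda)\in\overline{\mathcal{B}_a}$.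
   Context: $\mathbb{C}[\lambda]^{m\times n}_{d,r}$ is the set of complex $m\times n$ polynomial matrices of degree at most $d$ and normal rank (rank over $\mathbb{C}(\lambda)$) at most $r$. The degree of a polynomial vector is the maximum degree of its entries, with $\deg 0=-\infty$. $L_{*i}$ is the $i$th column of $L$, $R_{i*}$ the $i$th row of $R$. The space $\mathbb{C}[\lambda]^{m\times n}_d$ of polynomial matrices of degree at most $d$ is given the metric $\mathrm{dist}(P,Q)=(\sum_{i=0}^d\|P_i-Q_i\|_F^2)^{1/2}$ where $P=\sum_{i=0}^d\lambda^iP_i$, $Q=\sum_{i=0}^d\lambda^iQ_i$; closures $\overline{\mathcal{X}}$ are taken in this metric space. *)

theory Defs
  imports "HOL-Analysis.Analysis" "HOL-Computational_Algebra.Polynomial"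
    "HOL-Computational_Algebra.Fraction_Field" "Jordan_Normal_Form.DL_Rank"
begin

definition pvdeg :: "complex poly vec \<Rightarrow> ereal" where
  "pvdeg v = (if v = 0\<^sub>v (dim_vec v) then -\<infinity>
              else ereal (real (Max {degree (v $ i) | i. i < dim_vec v})))"

definition polymats :: "nat \<Rightarrow> nat \<Rightarrow> nat \<Rightarrow> complex poly mat set" where
  "polymats m n d = {P. P \<in> carrier_mat m n \<and> (\<forall>i<m. \<forall>j<n. degree (P $$ (i,j)) \<le> d)}"

definition normal_rank :: "complex poly mat \<Rightarrow> nat" where
  "normal_rank P = vec_space.rank (dim_row P) (map_mat to_fract P)"

definition polymats_rank :: "nat \<Rightarrow> nat \<Rightarrow> nat \<Rightarrow> nat \<Rightarrow> complex poly mat set" where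
  "polymats_rank m n d r = {P \<in> polymats m n d. normal_rank P \<le> r}"

definition pdist :: "nat \<Rightarrow> nat \<Rightarrow> nat \<Rightarrow> complex poly mat \<Rightarrow> complex poly mat \<Rightarrow> real" where
  "pdist m n d P Q = sqrt (\<Sum>k\<le>d. \<Sum>i<m. \<Sum>j<n.
      (cmod (coeff (P $$ (i,j)) k - coeff (Q $$ (i,j)) k))\<^sup>2)"

definition pclosure :: "nat \<Rightarrow> nat \<Rightarrow> nat \<Rightarrow> complex poly mat set \<Rightarrow> complex poly mat set" where
  "pclosure m n d X = {P \<in> polymats m n d.
      \<forall>e>0. \<exists>Q\<in>X \<inter> polymats m n d. pdist m n d P Q < e}"

text \<open>The sets A_a and B_a (indices 1..r of the paper become 0..r-1).\<close>
definition setA :: "nat \<Rightarrow> nat \<Rightarrow> nat \<Rightarrow> nat \<Rightarrow> nat \<Rightarrow> complex poly mat set" where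
  "setA m n r d a = {L * R | L R. L \<in> carrier_mat m r \<and> R \<in> carrier_mat r n \<and>
      (\<forall>i<r. pvdeg (col L i) + pvdeg (row R i) = ereal (real d)) \<and>
      (\<Sum>i<r. pvdeg (row R i)) = ereal (real a)}"

definition setB :: "nat \<Rightarrow> nat \<Rightarrow> nat \<Rightarrow> nat \<Rightarrow> nat \<Rightarrow> complex poly mat set" where
  "setB m n r d a = {L * R | L R. L \<in> carrier_mat m r \<and> R \<in> carrier_mat r n \<and>
      (\<forall>i<a mod r. pvdeg (row R i) = ereal (real (a div r + 1))) \<and>
      (\<forall>i. a mod r \<le> i \<and> i < r \<longrightarrow> pvdeg (row R i) = ereal (real (a div r))) \<and>
      (\<forall>i<r. pvdeg (col L i) = ereal (real d) - pvdeg (row R i))}"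

end

theory Submission
  imports Defs "HOL-Computational_Algebra.Fundamental_Theorem_Algebra"
begin

text \<open>
  A matrix of normal rank at most \<open>r\<close> and degree at most \<open>d\<close> is a product \<open>L R\<close> with
  \<open>R\<close> an (\<open>r\<close>-row) minimal basis of its row space in the sense of Forney, padded with zero rows; by
  the predictable degree property \<open>deg L\<^sub>k + deg R\<^sub>k \<le> d\<close> for each column \<open>L\<^sub>k\<close> and row
  \<open>R\<^sub>k\<close>. Hence it is a sum of \<open>r\<close> rank-one terms whose right factors have degree at most
  \<open>e\<^sub>k\<close> and whose left factors have degree at most \<open>d - e\<^sub>k\<close>. If \<open>e\<^sub>i > e\<^sub>j\<close>, an
  explicit perturbation with cancelling poles shows that such a sum is a limit of sums of the same kind with
  \<open>e\<^sub>i\<close> lowered and \<open>e\<^sub>j\<close> raised by one. Iterating, every bounded sum with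
  \<open>\<Sum>e\<^sub>k = a\<close> is a limit of sums with the balanced degrees of \<open>\<B>\<^sub>a\<close>, and a further
  perturbation makes these degrees exact. Conversely, limits of products through dimension \<open>r\<close> have vanishing
  minors of order \<open>r + 1\<close>, so their normal rank is at most \<open>r\<close>.
\<close>

section \<open>Closures of sets of polynomial matrices\<close>

text \<open>Applied to all entries of a matrix, this implies convergence in \<open>pdist\<close>,
  which involves finitely many coefficients. Unlike the metric, it is directly compatible with sums
  and products of polynomials.\<close>

definition coeff_tendsto :: "('a \<Rightarrow> complex poly) \<Rightarrow> complex poly \<Rightarrow> 'a filter \<Rightarrow> bool" where
  "coeff_tendsto p q F \<longleftrightarrow> (\<forall>k. ((\<lambda>t. coeff (p t) k) \<longlongrightarrow> coeff q k) F)"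

lemma coeff_tendsto_const: "coeff_tendsto (\<lambda>_. p) p F"
  by (simp add: coeff_tendsto_def)

lemma coeff_tendsto_monom: "(a \<longlongrightarrow> b) F \<Longrightarrow> coeff_tendsto (\<lambda>t. monom (a t) k) (monom b k) F"
  by (simp add: coeff_tendsto_def)

lemma coeff_tendsto_add:
  "coeff_tendsto p p' F \<Longrightarrow> coeff_tendsto q q' F \<Longrightarrow> coeff_tendsto (\<lambda>t. p t + q t) (p' + q') F"
  by (auto simp: coeff_tendsto_def intro!: tendsto_intros)

lemma coeff_tendsto_mult:
  "coeff_tendsto p p' F \<Longrightarrow> coeff_tendsto q q' F \<Longrightarrow> coeff_tendsto (\<lambda>t. p t * q t) (p' * q') F"
  unfolding coeff_tendsto_def coeff_mult by (intro allI tendsto_sum tendsto_mult) auto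

lemma coeff_tendsto_sum:
  "(\<And>i. i \<in> A \<Longrightarrow> coeff_tendsto (p i) (q i) F) \<Longrightarrow>
    coeff_tendsto (\<lambda>t. \<Sum>i\<in>A. p i t) (\<Sum>i\<in>A. q i) F"
  unfolding coeff_tendsto_def coeff_sum by (intro allI tendsto_sum) auto

text \<open>One nonnegative term is at most the whole sum. This turns closeness in
  \<open>pdist\<close> into convergence of individual coefficients.\<close>

lemma cmod_coeff_diff_le_pdist:
  assumes "i < m" "j < n" "k \<le> d"
  shows "cmod (coeff (P $$ (i,j)) k - coeff (Q $$ (i,j)) k) \<le> pdist m n d P Q"
proof -
  define f where "f k i j = (cmod (coeff (P $$ (i,j)) k - coeff (Q $$ (i,j)) k))\<^sup>2" for k i j
  have f0: "f k i j \<ge> 0" for k i j by (simp add: f_def)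
  have "f k i j \<le> (\<Sum>j<n. f k i j)"
    by (rule member_le_sum) (use assms f0 in auto)
  also have "\<dots> \<le> (\<Sum>i<m. \<Sum>j<n. f k i j)"
    by (rule member_le_sum[of i "{..<m}" "\<lambda>i. \<Sum>j<n. f k i j"]) (use assms f0 in \<open>auto intro: sum_nonneg\<close>)
  also have "\<dots> \<le> (\<Sum>k\<le>d. \<Sum>i<m. \<Sum>j<n. f k i j)"
    by (rule member_le_sum[of k "{..d}" "\<lambda>k. \<Sum>i<m. \<Sum>j<n. f k i j"])
      (use assms f0 in \<open>auto intro!: sum_nonneg\<close>)
  finally show ?thesis
    unfolding pdist_def f_def by (simp add: real_le_rsqrt)
qed

text \<open>A general filter admits both sequences and a complex perturbation parameter tending to
  0. The distance depends continuously on finitely many coefficients.\<close>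

lemma pclosureI:
  fixes F :: "'a filter"
  assumes "F \<noteq> bot" "P \<in> polymats m n d"
    and ev: "eventually (\<lambda>t. Q t \<in> X \<inter> polymats m n d) F"
    and lim: "\<And>i j k. i < m \<Longrightarrow> j < n \<Longrightarrow> k \<le> d \<Longrightarrow>
      ((\<lambda>t. coeff (Q t $$ (i,j)) k) \<longlongrightarrow> coeff (P $$ (i,j)) k) F"
  shows "P \<in> pclosure m n d X"
proof -
  have "((\<lambda>t. pdist m n d P (Q t)) \<longlongrightarrow>
     sqrt (\<Sum>k\<le>d. \<Sum>i<m. \<Sum>j<n. (cmod (coeff (P $$ (i,j)) k - coeff (P $$ (i,j)) k))\<^sup>2)) F"
    unfolding pdist_def by (intro tendsto_intros lim) auto
  hence "((\<lambda>t. pdist m n d P (Q t)) \<longlongrightarrow> 0) F" by simp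
  hence "\<exists>R\<in>X \<inter> polymats m n d. pdist m n d P R < e" if "e > 0" for e
    using eventually_happens'[OF assms(1) eventually_conj[OF ev order_tendstoD(2)[OF _ that]]]
    by blast
  with assms(2) show ?thesis by (simp add: pclosure_def)
qed

lemma pclosureE:
  assumes "P \<in> pclosure m n d X"
  obtains Q :: "nat \<Rightarrow> complex poly mat" where
    "\<And>t. Q t \<in> X \<inter> polymats m n d"
    "\<And>i j k. i < m \<Longrightarrow> j < n \<Longrightarrow> k \<le> d \<Longrightarrow>
      (\<lambda>t. coeff (Q t $$ (i,j)) k) \<longlonglongrightarrow> coeff (P $$ (i,j)) k"
proof -
  have "\<forall>t. \<exists>R. R \<in> X \<inter> polymats m n d \<and> pdist m n d P R < 1 / real (Suc t)"
    using assms unfolding pclosure_def by (simp add: Bex_def)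
  then obtain Q where Q: "\<And>t. Q t \<in> X \<inter> polymats m n d" "\<And>t. pdist m n d P (Q t) < 1 / real (Suc t)"
    by metis
  have "(\<lambda>t. coeff (Q t $$ (i,j)) k) \<longlonglongrightarrow> coeff (P $$ (i,j)) k"
    if ijk: "i < m" "j < n" "k \<le> d" for i j k
  proof (rule LIM_zero_cancel, rule Lim_null_comparison)
    show "eventually (\<lambda>t. norm (coeff (Q t $$ (i,j)) k - coeff (P $$ (i,j)) k) \<le> 1 / real (Suc t)) sequentially"
    proof (rule always_eventually, rule allI)
      show "norm (coeff (Q t $$ (i,j)) k - coeff (P $$ (i,j)) k) \<le> 1 / real (Suc t)" for t
        using cmod_coeff_diff_le_pdist[OF ijk, of P "Q t"] Q(2)[of t] by (simp add: norm_minus_commute)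
    qed
    show "(\<lambda>t. 1 / real (Suc t)) \<longlonglongrightarrow> 0"
      using LIMSEQ_inverse_real_of_nat by (simp add: divide_inverse)
  qed
  with Q(1) that show thesis by blast
qed

lemma subset_pclosure: "X \<inter> polymats m n d \<subseteq> pclosure m n d X"
  by (auto intro!: pclosureI[where F = sequentially and Q = "\<lambda>_. P" for P])

lemma pclosure_mono: "X \<subseteq> Y \<Longrightarrow> pclosure m n d X \<subseteq> pclosure m n d Y"
  unfolding pclosure_def by blast

text \<open>Idempotence of closure, in the form that lets approximations be chained: if
  \<open>Q t\<close> tends to \<open>P\<close> and \<open>R t\<close> is within
  \<open>1 / real (Suc t)\<close> of \<open>Q t\<close>, then \<open>R t\<close> tends to
  \<open>P\<close> as well.\<close>

lemma pclosure_minimal: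
  assumes "X \<inter> polymats m n d \<subseteq> pclosure m n d Y"
  shows "pclosure m n d X \<subseteq> pclosure m n d Y"
proof
  fix P assume P: "P \<in> pclosure m n d X"
  then obtain Q where Q: "\<And>t::nat. Q t \<in> X \<inter> polymats m n d"
    and Qlim: "\<And>i j k. i < m \<Longrightarrow> j < n \<Longrightarrow> k \<le> d \<Longrightarrow>
      (\<lambda>t. coeff (Q t $$ (i,j)) k) \<longlonglongrightarrow> coeff (P $$ (i,j)) k"
    by (rule pclosureE) blast
  have "\<exists>R. R \<in> Y \<inter> polymats m n d \<and> pdist m n d (Q t) R < 1 / real (Suc t)" for t
    using Q[of t] assms unfolding pclosure_def by (auto simp: Bex_def)
  then obtain R where R: "\<And>t. R t \<in> Y \<inter> polymats m n d"
      "\<And>t. pdist m n d (Q t) (R t) < 1 / real (Suc t)"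
    by metis
  show "P \<in> pclosure m n d Y"
  proof (rule pclosureI[where F = sequentially and Q = R])
    fix i j k assume ijk: "i < m" "j < n" "k \<le> d"
    have "(\<lambda>t. coeff (R t $$ (i,j)) k - coeff (Q t $$ (i,j)) k) \<longlonglongrightarrow> 0"
    proof (rule Lim_null_comparison)
      show "eventually (\<lambda>t. norm (coeff (R t $$ (i,j)) k - coeff (Q t $$ (i,j)) k) \<le> 1 / real (Suc t)) sequentially"
      proof (rule always_eventually, rule allI)
        show "norm (coeff (R t $$ (i,j)) k - coeff (Q t $$ (i,j)) k) \<le> 1 / real (Suc t)" for t
          using cmod_coeff_diff_le_pdist[OF ijk, of "Q t" "R t"] R(2)[of t] by (simp add: norm_minus_commute)
      qed
      show "(\<lambda>t. 1 / real (Suc t)) \<longlonglongrightarrow> 0"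
        using LIMSEQ_inverse_real_of_nat by (simp add: divide_inverse)
    qed
    from tendsto_add[OF this Qlim[OF ijk]]
    show "(\<lambda>t. coeff (R t $$ (i,j)) k) \<longlonglongrightarrow> coeff (P $$ (i,j)) k" by simp
  qed (use P R in \<open>auto simp: pclosure_def\<close>)
qed

section \<open>Balancing the degrees\<close>

text \<open>The bound on \<open>u\<close> is written as a sum to avoid truncated subtraction; for
  \<open>m > 0\<close> it also forces \<open>e k \<le> d\<close>.\<close>

definition bounded_products :: "nat \<Rightarrow> nat \<Rightarrow> nat \<Rightarrow> nat \<Rightarrow> (nat \<Rightarrow> nat) \<Rightarrow> complex poly mat set" where
  "bounded_products m n r d e = {P \<in> carrier_mat m n. \<exists>u v.
      (\<forall>i<m. \<forall>k<r. degree (u i k) + e k \<le> d) \<and> (\<forall>k<r. \<forall>j<n. degree (v k j) \<le> e k) \<and>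
      (\<forall>i<m. \<forall>j<n. P $$ (i,j) = (\<Sum>k<r. u i k * v k j))}"

lemma bounded_productsE:
  assumes "P \<in> bounded_products m n r d e"
  obtains u v where "P \<in> carrier_mat m n"
    and "\<And>i k. i < m \<Longrightarrow> k < r \<Longrightarrow> degree (u i k) + e k \<le> d"
    and "\<And>k j. k < r \<Longrightarrow> j < n \<Longrightarrow> degree (v k j) \<le> e k"
    and "\<And>i j. i < m \<Longrightarrow> j < n \<Longrightarrow> P $$ (i,j) = (\<Sum>k<r. u i k * v k j)"
proof -
  from assms obtain u v where "P \<in> carrier_mat m n"
      "\<forall>i<m. \<forall>k<r. degree (u i k) + e k \<le> d" "\<forall>k<r. \<forall>j<n. degree (v k j) \<le> e k"
      "\<forall>i<m. \<forall>j<n. P $$ (i,j) = (\<Sum>k<r. u i k * v k j)"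
    unfolding bounded_products_def mem_Collect_eq by (elim conjE exE)
  thus thesis by (intro that) simp_all
qed

lemma bounded_products_subset_polymats: "bounded_products m n r d e \<subseteq> polymats m n d"
proof
  fix P assume "P \<in> bounded_products m n r d e"
  then obtain u v where P: "P \<in> carrier_mat m n"
    and u: "\<And>i k. i < m \<Longrightarrow> k < r \<Longrightarrow> degree (u i k) + e k \<le> d"
    and v: "\<And>k j. k < r \<Longrightarrow> j < n \<Longrightarrow> degree (v k j) \<le> e k"
    and Puv: "\<And>i j. i < m \<Longrightarrow> j < n \<Longrightarrow> P $$ (i,j) = (\<Sum>k<r. u i k * v k j)"
    by (rule bounded_productsE) blast
  have "degree (P $$ (i,j)) \<le> d" if "i < m" "j < n" for i j
    unfolding Puv[OF that]
  proof (rule degree_sum_le)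
    fix k assume "k \<in> {..<r}"
    thus "degree (u i k * v k j) \<le> d"
      using degree_mult_le[of "u i k" "v k j"] u[of i k] v[of k j] that by force
  qed simp
  with P show "P \<in> polymats m n d" by (simp add: polymats_def)
qed

lemma degree_le_pred:
  assumes "degree p \<le> k" "coeff p k = 0" "k > 0"
  shows "degree p \<le> k - 1"
proof (rule degree_le, intro allI impI)
  fix l assume "k - 1 < l"
  thus "coeff p l = 0" using assms by (cases "l = k") (auto intro: coeff_eq_0)
qed

text \<open>A summand \<open>u v + w z\<close> with \<open>deg v = p > q = deg z\<close> is the limit of
  \<open>u' v + w z'\<close>, where \<open>z' = z + \<epsilon> v\<^sub>p x\<^sup>q\<^sup>+\<^sup>1\<close> and
  \<open>u' = u - \<epsilon> w\<^sub>d\<^sub>-\<^sub>q x\<^sup>d\<^sup>-\<^sup>p\<^sup>+\<^sup>1\<close>. This equals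
  \<open>u' v' + w' z'\<close> with \<open>v' = v - \<epsilon>\<^sup>-\<^sup>1 x\<^sup>p\<^sup>-\<^sup>q\<^sup>-\<^sup>1 z'\<close> and
  \<open>w' = w + \<epsilon>\<^sup>-\<^sup>1 x\<^sup>p\<^sup>-\<^sup>q\<^sup>-\<^sup>1 u'\<close>, in both of which the top coefficient cancels.\<close>
lemma bounded_products_transfer:
  assumes ab: "a < r" "b < r" and eab: "e b < e a"
  shows "bounded_products m n r d e \<subseteq>
    pclosure m n d (bounded_products m n r d (e(a := e a - 1, b := e b + 1)))"
proof
  fix P assume P: "P \<in> bounded_products m n r d e"
  then obtain u v where Pc: "P \<in> carrier_mat m n"
    and u: "\<And>i k. i < m \<Longrightarrow> k < r \<Longrightarrow> degree (u i k) + e k \<le> d"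
    and v: "\<And>k j. k < r \<Longrightarrow> j < n \<Longrightarrow> degree (v k j) \<le> e k"
    and Puv: "\<And>i j. i < m \<Longrightarrow> j < n \<Longrightarrow> P $$ (i,j) = (\<Sum>k<r. u i k * v k j)"
    by (rule bounded_productsE) blast
  define p q where "p = e a" and "q = e b"
  have pq: "q < p" using eab by (simp add: p_def q_def)
  have anb: "a \<noteq> b" using eab by auto
  \<comment> \<open>In the notation of the remark above the lemma, w and z are \<open>u i b\<close>
    and \<open>v b j\<close>, while \<open>w t i\<close> and \<open>z t j\<close> are w' and z'. The
    monomial \<open>x i\<close> serves to cancel the coefficient of \<open>w t i\<close> at
    \<open>d - q\<close>, and \<open>y j\<close> that of \<open>v' t j\<close> at
    \<open>p\<close>.\<close>
  define x where "x i = monom (coeff (u i b) (d - q)) (d - p + 1)" for i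
  define y where "y j = monom (coeff (v a j) p) (q + 1)" for j
  define z where "z t j = v b j + Polynomial.smult t (y j)" for t j
  define v' where "v' t j = v a j - Polynomial.smult (1/t) (monom 1 (p - q - 1) * z t j)" for t j
  define u' where "u' t i = u i a - Polynomial.smult t (x i)" for t i
  define w where "w t i = u i b + Polynomial.smult (1/t) (monom 1 (p - q - 1) * u' t i)" for t i
  \<comment> \<open>\<open>G\<close> is the exact linear change of the two summands in
    \<open>t\<close>. Hence \<open>Q t\<close> visibly tends to \<open>P\<close>, although
    \<open>v'\<close> and \<open>w\<close> have poles at 0.\<close>
  define G where "G i j = u i b * y j - x i * v a j" for i j
  define Q where "Q t = Matrix.mat m n (\<lambda>(i,j). P $$ (i,j) + Polynomial.smult t (G i j))" for t
  have Qin: "Q t \<in> bounded_products m n r d (e(a := e a - 1, b := e b + 1))" (is "_ \<in> bounded_products _ _ _ _ ?e")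
    if t: "t \<noteq> 0" for t
  proof -
    define U where "U i k = (if k = a then u' t i else if k = b then w t i else u i k)" for i k
    define V where "V k j = (if k = a then v' t j else if k = b then z t j else v k j)" for k j
    have du': "degree (u' t i) \<le> d - p + 1" if "i < m" for i
      unfolding u'_def x_def using u[OF that ab(1)]
      by (intro degree_diff_le order.trans[OF degree_smult_le]) (auto simp: p_def intro: order.trans[OF degree_monom_le])
    have dz: "degree (z t j) \<le> q + 1" if "j < n" for j
      unfolding z_def y_def using v[OF ab(2) that]
      by (intro degree_add_le order.trans[OF degree_smult_le]) (auto simp: q_def intro: order.trans[OF degree_monom_le])
    have dv': "degree (v' t j) \<le> p - 1" if "j < n" for j
    proof (rule degree_le_pred)
      have "degree (monom 1 (p - q - 1) * z t j) \<le> p"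
        using degree_mult_le[of "monom 1 (p - q - 1)" "z t j"] dz[OF that] pq degree_monom_le[of "1::complex" "p - q - 1"]
        by linarith
      thus "degree (v' t j) \<le> p"
        unfolding v'_def using v[OF ab(1) that]
        by (intro degree_diff_le order.trans[OF degree_smult_le]) (auto simp: p_def)
      have "coeff (v b j) (q + 1) = 0" using v[OF ab(2) that] by (intro coeff_eq_0) (simp add: q_def)
      hence "coeff (z t j) (q + 1) = t * coeff (v a j) p" by (simp add: z_def y_def)
      moreover have "p - (p - q - 1) = q + 1" using pq by simp
      ultimately show "coeff (v' t j) p = 0" using t pq
        by (simp add: v'_def coeff_monom_mult)
    qed (use pq in simp)
    have dw: "degree (w t i) \<le> d - q - 1" if "i < m" for i
    proof (rule degree_le_pred)
      have pd: "p \<le> d" using u[OF that ab(1)] by (simp add: p_def)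
      have "degree (monom 1 (p - q - 1) * u' t i) \<le> d - q"
        using degree_mult_le[of "monom 1 (p - q - 1)" "u' t i"] du'[OF that] pq pd degree_monom_le[of "1::complex" "p - q - 1"]
        by linarith
      thus "degree (w t i) \<le> d - q"
        unfolding w_def using u[OF that ab(2)]
        by (intro degree_add_le order.trans[OF degree_smult_le]) (auto simp: q_def)
      have "coeff (u i a) (d - p + 1) = 0" using u[OF that ab(1)] by (intro coeff_eq_0) (simp add: p_def)
      hence "coeff (u' t i) (d - p + 1) = - t * coeff (u i b) (d - q)" by (simp add: u'_def x_def)
      moreover have "d - q - (p - q - 1) = d - p + 1" "p - q - 1 \<le> d - q" using pq pd by auto
      ultimately show "coeff (w t i) (d - q) = 0" using t pq
        by (simp add: w_def coeff_monom_mult)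
      show "d - q > 0" using pq pd by simp
    qed
    have "degree (U i k) + ?e k \<le> d" if "i < m" "k < r" for i k
      using du'[OF that(1)] dw[OF that(1)] u[OF that] u[OF that(1) ab(1)] u[OF that(1) ab(2)] pq anb
      by (auto simp: U_def p_def q_def)
    moreover have "degree (V k j) \<le> ?e k" if "k < r" "j < n" for k j
      using dv'[OF that(2)] dz[OF that(2)] v[OF that] by (auto simp: V_def p_def q_def)
    moreover have "Q t $$ (i,j) = (\<Sum>k<r. U i k * V k j)" if ij: "i < m" "j < n" for i j
    proof -
      have split: "(\<Sum>k<r. h k) = h a + h b + (\<Sum>k\<in>{..<r} - {a,b}. h k)" for h :: "nat \<Rightarrow> complex poly"
        using ab anb by (subst sum.subset_diff[of "{a,b}"]) (auto simp: add.commute)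
      \<comment> \<open>The two terms with factor \<open>1/t\<close> are
        \<open>monom 1 (p - q - 1) * u' t i * z t j\<close> with opposite signs.\<close>
      have "u' t i * v' t j + w t i * z t j = u' t i * v a j + u i b * z t j"
        by (simp add: v'_def w_def algebra_simps)
      also have "\<dots> = u i a * v a j + u i b * v b j + Polynomial.smult t (G i j)"
        by (simp add: u'_def z_def G_def algebra_simps smult_diff_right)
      finally have "(\<Sum>k<r. U i k * V k j) = (\<Sum>k<r. u i k * v k j) + Polynomial.smult t (G i j)"
        unfolding split using anb by (simp add: U_def V_def)
      thus ?thesis using ij by (simp add: Q_def Puv)
    qed
    ultimately show ?thesis unfolding bounded_products_def mem_Collect_eq
      by (intro conjI exI[of _ U] exI[of _ V]) (simp_all add: Q_def)
  qed
  show "P \<in> pclosure m n d (bounded_products m n r d (e(a := e a - 1, b := e b + 1)))"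
  proof (rule pclosureI[where F = "at (0::complex)" and Q = Q])
    show "\<forall>\<^sub>F t in at 0. Q t \<in> bounded_products m n r d (e(a := e a - 1, b := e b + 1)) \<inter> polymats m n d"
      unfolding eventually_at_filter
      by (rule always_eventually) (use Qin bounded_products_subset_polymats in blast)
    show "((\<lambda>t. coeff (Q t $$ (i,j)) k) \<longlongrightarrow> coeff (P $$ (i,j)) k) (at 0)" if "i < m" "j < n" for i j k
    proof -
      have "((\<lambda>t. coeff (P $$ (i,j)) k + t * coeff (G i j) k) \<longlongrightarrow> coeff (P $$ (i,j)) k + 0 * coeff (G i j) k) (at 0)"
        by (intro tendsto_intros)
      thus ?thesis using that by (simp add: Q_def)
    qed
  qed (use P bounded_products_subset_polymats in \<open>simp_all add: subset_iff\<close>)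
qed

text \<open>Induction on the l1 distance from \<open>e\<close> to \<open>b\<close>; the two
  truncated differences add up to the absolute one. If \<open>e\<close> differs from
  \<open>b\<close>, equality of the sums gives \<open>i\<close> with \<open>b i < e i\<close> and
  \<open>j\<close> with \<open>e j < b j\<close>. Then
  \<open>e j < b j \<le> b i + 1 \<le> e i\<close>, so one unit can be transferred from
  \<open>i\<close> to \<open>j\<close>, which lowers the distance by 2.\<close>

lemma bounded_products_subset_pclosure_balanced:
  assumes bal: "\<And>i j. i < r \<Longrightarrow> j < r \<Longrightarrow> b i \<le> b j + (1::nat)"
  assumes "(\<Sum>k<r. e k) = (\<Sum>k<r. b k)"
  shows "bounded_products m n r d e \<subseteq> pclosure m n d (bounded_products m n r d b)"
  using assms(2)
proof (induction "\<Sum>k<r. (e k - b k) + (b k - e k)" arbitrary: e rule: less_induct)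
  case less
  show ?case
  proof (cases "\<forall>k<r. e k = b k")
    case True
    hence "bounded_products m n r d e = bounded_products m n r d b"
      unfolding bounded_products_def by auto
    thus ?thesis
      using subset_pclosure[of "bounded_products m n r d b" m n d] bounded_products_subset_polymats
      by blast
  next
    case False
    have "\<exists>i<r. b i < e i"
    proof (rule ccontr)
      assume "\<not> ?thesis"
      hence "\<forall>k\<in>{..<r}. e k \<le> b k" by (meson lessThan_iff not_less)
      moreover obtain k where "k < r" "e k \<noteq> b k" using False by blast
      ultimately show False using sum_strict_mono_ex1[of "{..<r}" e b] less.prems
        by (metis finite_lessThan lessThan_iff nat_neq_iff not_less)
    qed
    then obtain i where i: "i < r" "b i < e i" by blast
    have "\<exists>j<r. e j < b j"
    proof (rule ccontr)
      assume "\<not> ?thesis"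
      hence "\<forall>k\<in>{..<r}. b k \<le> e k" by (meson lessThan_iff not_less)
      thus False using i sum_strict_mono_ex1[of "{..<r}" b e] less.prems by auto
    qed
    then obtain j where j: "j < r" "e j < b j" by blast
    have ij: "i \<noteq> j" using i j by auto
    have lt: "e j < e i" using bal[of j i] i j by simp
    define e' where "e' = e(i := e i - 1, j := e j + 1)"
    have split: "(\<Sum>k<r. h k) = h i + h j + (\<Sum>k\<in>{..<r} - {i,j}. h k)" for h :: "nat \<Rightarrow> nat"
      using i j ij by (subst sum.subset_diff[of "{i,j}"]) (auto simp: add.commute)
    have rest: "(\<Sum>k\<in>{..<r} - {i,j}. h k (e' k)) = (\<Sum>k\<in>{..<r} - {i,j}. h k (e k))" for h :: "nat \<Rightarrow> nat \<Rightarrow> nat"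
      by (rule sum.cong) (auto simp: e'_def)
    have "(\<Sum>k<r. e' k) = (\<Sum>k<r. e k)"
      unfolding split rest[of "\<lambda>k x. x"] using ij lt by (simp add: e'_def)
    moreover have "(\<Sum>k<r. (e' k - b k) + (b k - e' k)) < (\<Sum>k<r. (e k - b k) + (b k - e k))"
      unfolding split rest[of "\<lambda>k x. (x - b k) + (b k - x)"] using ij i j by (simp add: e'_def)
    ultimately have "bounded_products m n r d e' \<subseteq> pclosure m n d (bounded_products m n r d b)"
      using less by simp
    moreover have "bounded_products m n r d e \<subseteq> pclosure m n d (bounded_products m n r d e')"
      unfolding e'_def using bounded_products_transfer i j lt by blast
    ultimately show ?thesis using pclosure_minimal by blast
  qed
qed

section \<open>Exact degrees and the sets \<open>setA\<close> and \<open>setB\<close>\<close>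

lemma pvdeg_eq_iff:
  "pvdeg v = ereal (real k) \<longleftrightarrow>
    (\<forall>i<dim_vec v. degree (v $ i) \<le> k) \<and> (\<exists>i<dim_vec v. v $ i \<noteq> 0 \<and> degree (v $ i) = k)"
  (is "_ \<longleftrightarrow> ?rhs")
proof (cases "v = 0\<^sub>v (dim_vec v)")
  case True
  hence "v $ i = 0" if "i < dim_vec v" for i
    using that by (metis index_zero_vec(1))
  with True show ?thesis by (auto simp: pvdeg_def)
next
  case False
  then obtain i0 where i0: "i0 < dim_vec v" "v $ i0 \<noteq> 0" by (auto simp: vec_eq_iff)
  let ?S = "{degree (v $ i) | i. i < dim_vec v}"
  have S: "finite ?S" "?S \<noteq> {}" using i0 by auto
  have "pvdeg v = ereal (real k) \<longleftrightarrow> Max ?S = k" using False by (simp add: pvdeg_def)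
  also have "\<dots> \<longleftrightarrow> (\<forall>i<dim_vec v. degree (v $ i) \<le> k) \<and> (\<exists>i<dim_vec v. degree (v $ i) = k)"
    using S by (subst Max_eq_iff) auto
  \<comment> \<open>The zero polynomial has \<open>degree\<close> 0, so the witness could be a zero
    entry only if \<open>k = 0\<close>; then every entry has degree 0 and the nonzero entry
    \<open>i0\<close> serves instead.\<close>
  also have "\<dots> \<longleftrightarrow> ?rhs"
    using i0 by (metis degree_0 le_zero_eq)
  finally show ?thesis .
qed

lemma pvdeg_cases:
  obtains "pvdeg v = -\<infinity>" | k where "pvdeg v = ereal (real k)"
  by (cases "v = 0\<^sub>v (dim_vec v)") (auto simp: pvdeg_def)

text \<open>A common form for both families: \<open>setB\<close> is the case of balanced
  \<open>e\<close>, and each element of \<open>setA\<close> lies in one such set with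
  \<open>e\<close> summing to \<open>a\<close>. The conjunct \<open>e k \<le> d\<close> keeps
  \<open>d - e k\<close> from being truncated.\<close>

definition degree_products :: "nat \<Rightarrow> nat \<Rightarrow> nat \<Rightarrow> nat \<Rightarrow> (nat \<Rightarrow> nat) \<Rightarrow> complex poly mat set" where
  "degree_products m n r d e = {L * R | L R. L \<in> carrier_mat m r \<and> R \<in> carrier_mat r n \<and>
      (\<forall>k<r. e k \<le> d \<and> pvdeg (col L k) = ereal (real (d - e k)) \<and> pvdeg (row R k) = ereal (real (e k)))}"

lemma degree_products_subset_bounded_products:
  "degree_products m n r d e \<subseteq> bounded_products m n r d e"
proof
  fix P assume "P \<in> degree_products m n r d e"
  then obtain L R where P: "P = L * R" and L: "L \<in> carrier_mat m r" and R: "R \<in> carrier_mat r n"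
    and deg: "\<And>k. k < r \<Longrightarrow> e k \<le> d \<and> pvdeg (col L k) = ereal (real (d - e k)) \<and> pvdeg (row R k) = ereal (real (e k))"
    unfolding degree_products_def by blast
  have "degree (L $$ (i,k)) + e k \<le> d" if "i < m" "k < r" for i k
    using deg[OF that(2)] that L pvdeg_eq_iff[of "col L k"] by fastforce
  moreover have "degree (R $$ (k,j)) \<le> e k" if "k < r" "j < n" for k j
    using deg[OF that(1)] that R pvdeg_eq_iff[of "row R k"] by fastforce
  moreover have "P $$ (i,j) = (\<Sum>k<r. L $$ (i,k) * R $$ (k,j))" if "i < m" "j < n" for i j
    using that L R by (simp add: P scalar_prod_def atLeast0LessThan)
  ultimately show "P \<in> bounded_products m n r d e"
    unfolding bounded_products_def mem_Collect_eq using P L R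
    by (intro conjI exI[of _ "\<lambda>i k. L $$ (i,k)"] exI[of _ "\<lambda>k j. R $$ (k,j)"]) simp_all
qed

text \<open>Adding \<open>\<epsilon> x\<^sup>l\<close> to one entry of a vector of degree at most \<open>l\<close> makes the degree
  exactly \<open>l\<close> for all but one value of \<open>\<epsilon>\<close>.\<close>
lemma bounded_products_subset_pclosure:
  assumes mn: "m > 0" "n > 0"
  shows "bounded_products m n r d e \<subseteq> pclosure m n d (degree_products m n r d e)"
proof
  fix P assume P: "P \<in> bounded_products m n r d e"
  then obtain u v where Pc: "P \<in> carrier_mat m n"
    and u: "\<And>i k. i < m \<Longrightarrow> k < r \<Longrightarrow> degree (u i k) + e k \<le> d"
    and v: "\<And>k j. k < r \<Longrightarrow> j < n \<Longrightarrow> degree (v k j) \<le> e k"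
    and Puv: "\<And>i j. i < m \<Longrightarrow> j < n \<Longrightarrow> P $$ (i,j) = (\<Sum>k<r. u i k * v k j)"
    by (rule bounded_productsE) blast
  \<comment> \<open>Entry 0 of each column and row exists by \<open>mn\<close>; it alone is
    perturbed, in the highest degree allowed.\<close>
  define u' where "u' t i k = u i k + (if i = 0 then monom t (d - e k) else 0)" for t i k
  define v' where "v' t k j = v k j + (if j = 0 then monom t (e k) else 0)" for t k j
  define L where "L t = Matrix.mat m r (\<lambda>(i,k). u' t i k)" for t
  define R where "R t = Matrix.mat r n (\<lambda>(k,j). v' t k j)" for t
  have LR: "(L t * R t) $$ (i,j) = (\<Sum>k<r. u' t i k * v' t k j)" if "i < m" "j < n" for t i j
    using that by (simp add: L_def R_def scalar_prod_def atLeast0LessThan)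
  have ev: "\<forall>\<^sub>F t in at 0. c + t \<noteq> 0" for c :: complex
  proof (cases "c = 0")
    case True
    thus ?thesis by (simp add: eventually_at_filter)
  next
    case False
    have "((\<lambda>t. c + t) \<longlongrightarrow> c + 0) (at 0)" by (intro tendsto_intros)
    from tendsto_imp_eventually_ne[OF this] False show ?thesis by simp
  qed
  \<comment> \<open>Each of the finitely many \<open>k\<close> excludes at most two values of
    \<open>t\<close>, so near 0 all top coefficients are nonzero at once.\<close>
  have "\<forall>\<^sub>F t in at 0. \<forall>k\<in>{..<r}. coeff (u 0 k) (d - e k) + t \<noteq> 0 \<and> coeff (v k 0) (e k) + t \<noteq> 0"
    by (intro eventually_ball_finite ballI eventually_conj ev) simp
  hence "\<forall>\<^sub>F t in at 0. L t * R t \<in> degree_products m n r d e"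
  proof (rule eventually_mono)
    fix t assume t: "\<forall>k\<in>{..<r}. coeff (u 0 k) (d - e k) + t \<noteq> 0 \<and> coeff (v k 0) (e k) + t \<noteq> 0"
    have "e k \<le> d \<and> pvdeg (col (L t) k) = ereal (real (d - e k)) \<and> pvdeg (row (R t) k) = ereal (real (e k))"
      if k: "k < r" for k
    proof (intro conjI)
      show ed: "e k \<le> d" using u[OF mn(1) k] by simp
      have du: "degree (u' t i k) \<le> d - e k" if "i < m" for i
        using u[OF that k] degree_monom_le[of t "d - e k"] by (auto simp: u'_def intro!: degree_add_le)
      have dv: "degree (v' t k j) \<le> e k" if "j < n" for j
        using v[OF k that] degree_monom_le[of t "e k"] by (auto simp: v'_def intro!: degree_add_le)
      have cu: "coeff (u' t 0 k) (d - e k) \<noteq> 0" and cv: "coeff (v' t k 0) (e k) \<noteq> 0"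
        using t k by (simp_all add: u'_def v'_def)
      have "degree (u' t 0 k) = d - e k" "u' t 0 k \<noteq> 0" "degree (v' t k 0) = e k" "v' t k 0 \<noteq> 0"
        using du[OF mn(1)] dv[OF mn(2)] le_degree[OF cu] le_degree[OF cv] cu cv by auto
      thus "pvdeg (col (L t) k) = ereal (real (d - e k))" "pvdeg (row (R t) k) = ereal (real (e k))"
        unfolding pvdeg_eq_iff using du dv mn k by (auto simp: L_def R_def)
    qed
    thus "L t * R t \<in> degree_products m n r d e"
      unfolding degree_products_def mem_Collect_eq
      by (intro exI[of _ "L t"] exI[of _ "R t"]) (simp add: L_def R_def)
  qed
  hence ev2: "\<forall>\<^sub>F t in at 0. L t * R t \<in> degree_products m n r d e \<inter> polymats m n d"
    by (rule eventually_mono)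
      (use degree_products_subset_bounded_products bounded_products_subset_polymats in blast)
  show "P \<in> pclosure m n d (degree_products m n r d e)"
  proof (rule pclosureI[OF _ _ ev2])
    show "P \<in> polymats m n d" using P bounded_products_subset_polymats by blast
    fix i j l assume ij: "i < m" "j < n"
    have "coeff_tendsto (\<lambda>t. p + (if c then monom t l else 0)) p (at 0)" for p c l
    proof -
      have "coeff_tendsto (\<lambda>t. p + monom t l) (p + monom 0 l) (at 0)"
        by (intro coeff_tendsto_add coeff_tendsto_const coeff_tendsto_monom tendsto_ident_at)
      thus ?thesis by (cases c) (simp_all add: coeff_tendsto_const)
    qed
    hence "coeff_tendsto (\<lambda>t. u' t i k) (u i k) (at 0)" "coeff_tendsto (\<lambda>t. v' t k j) (v k j) (at 0)" for k
      by (simp_all only: u'_def v'_def)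
    hence "coeff_tendsto (\<lambda>t. \<Sum>k<r. u' t i k * v' t k j) (\<Sum>k<r. u i k * v k j) (at 0)"
      by (intro coeff_tendsto_sum coeff_tendsto_mult)
    thus "((\<lambda>t. coeff ((L t * R t) $$ (i,j)) l) \<longlongrightarrow> coeff (P $$ (i,j)) l) (at 0)"
      using ij by (simp add: LR Puv coeff_tendsto_def)
  qed simp
qed

text \<open>A column degree and a row degree with finite sum \<open>d\<close> cannot be
  \<open>-\<infinity>\<close>, so no column or row is zero and the row degrees are natural numbers
  at most \<open>d\<close>.\<close>

lemma setA_subset_bounded_products:
  assumes "P \<in> setA m n r d a"
  obtains e where "(\<Sum>k<r. e k) = a" "P \<in> bounded_products m n r d e"
proof -
  from assms obtain L R where P: "P = L * R" and L: "L \<in> carrier_mat m r" and R: "R \<in> carrier_mat r n"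
    and deg: "\<And>k. k < r \<Longrightarrow> pvdeg (col L k) + pvdeg (row R k) = ereal (real d)"
    and sum: "(\<Sum>k<r. pvdeg (row R k)) = ereal (real a)"
    unfolding setA_def by blast
  have "\<exists>e. pvdeg (row R k) = ereal (real e) \<and> e \<le> d \<and> pvdeg (col L k) = ereal (real (d - e))"
    if "k < r" for k
    using deg[OF that]
    by (cases "col L k" rule: pvdeg_cases; cases "row R k" rule: pvdeg_cases) force+
  then obtain e where e: "\<And>k. k < r \<Longrightarrow> pvdeg (row R k) = ereal (real (e k)) \<and> e k \<le> d \<and>
      pvdeg (col L k) = ereal (real (d - e k))" by metis
  have "(\<Sum>k<r. pvdeg (row R k)) = ereal (real (\<Sum>k<r. e k))"
    by (simp add: e)
  with sum have "(\<Sum>k<r. e k) = a" by (metis ereal.inject of_nat_eq_iff)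
  moreover have "P \<in> degree_products m n r d e"
    unfolding degree_products_def mem_Collect_eq using P L R e by blast
  ultimately show thesis using that degree_products_subset_bounded_products by blast
qed

text \<open>The row degrees prescribed by \<open>setB\<close>. Any two differ by at most 1, as the
  target of the balancing lemma must.\<close>

abbreviation balanced :: "nat \<Rightarrow> nat \<Rightarrow> nat \<Rightarrow> nat" where
  "balanced r a k \<equiv> if k < a mod r then a div r + 1 else a div r"

lemma sum_balanced:
  assumes "r > 0"
  shows "(\<Sum>k<r. balanced r a k) = a"
proof -
  have "(\<Sum>k<r. balanced r a k) = (\<Sum>k<r. a div r + (if k < a mod r then 1 else 0))"
    by (rule sum.cong) auto
  also have "\<dots> = r * (a div r) + card ({..<r} \<inter> {k. k < a mod r})"
    by (simp add: sum.distrib sum.If_cases)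
  also have "{..<r} \<inter> {k. k < a mod r} = {..<a mod r}"
    using mod_less_divisor[OF assms, of a] by auto
  finally show ?thesis by simp
qed

text \<open>For \<open>a = r * d\<close> the remainder is 0 and no row gets the extra 1; otherwise
  \<open>a div r < d\<close> leaves room for it.\<close>

lemma balanced_le:
  assumes "a \<le> r * d" "k < r"
  shows "balanced r a k \<le> d"
proof (cases "a = r * d")
  case False
  hence "a div r < d" using assms by (simp add: less_mult_imp_div_less mult.commute)
  thus ?thesis by simp
qed (use assms in auto)

lemma setB_eq_degree_products:
  assumes "r > 0" "a \<le> r * d"
  shows "setB m n r d a = degree_products m n r d (balanced r a)"
proof -
  have "((\<forall>i<a mod r. pvdeg (row R i) = ereal (real (a div r + 1))) \<and>
      (\<forall>i. a mod r \<le> i \<and> i < r \<longrightarrow> pvdeg (row R i) = ereal (real (a div r))) \<and>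
      (\<forall>i<r. pvdeg (col L i) = ereal (real d) - pvdeg (row R i))) \<longleftrightarrow>
    (\<forall>k<r. balanced r a k \<le> d \<and> pvdeg (col L k) = ereal (real (d - balanced r a k)) \<and>
      pvdeg (row R k) = ereal (real (balanced r a k)))" (is "?l \<longleftrightarrow> ?r") for L R
  proof -
    have "?l \<longleftrightarrow> (\<forall>k<r. pvdeg (row R k) = ereal (real (balanced r a k)) \<and>
        pvdeg (col L k) = ereal (real d) - pvdeg (row R k))"
      using mod_less_divisor[OF assms(1), of a] by (auto simp: not_less)
    also have "\<dots> \<longleftrightarrow> ?r"
    proof (intro all_cong1 imp_cong refl)
      fix k assume "k < r"
      from balanced_le[OF assms(2) this]
      have "ereal (real d) - ereal (real (balanced r a k)) = ereal (real (d - balanced r a k))"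
        by (simp add: of_nat_diff)
      with balanced_le[OF assms(2) \<open>k < r\<close>]
      show "(pvdeg (row R k) = ereal (real (balanced r a k)) \<and>
        pvdeg (col L k) = ereal (real d) - pvdeg (row R k)) \<longleftrightarrow> (balanced r a k \<le> d \<and> pvdeg (col L k) = ereal (real (d - balanced r a k)) \<and>
      pvdeg (row R k) = ereal (real (balanced r a k)))"
        by metis
    qed
    finally show ?thesis .
  qed
  thus ?thesis unfolding setB_def degree_products_def by simp
qed

lemma setB_subset_setA:
  assumes "r > 0" "a \<le> r * d"
  shows "setB m n r d a \<subseteq> setA m n r d a"
proof
  fix P assume "P \<in> setB m n r d a"
  then obtain L R where LR: "P = L * R" "L \<in> carrier_mat m r" "R \<in> carrier_mat r n"
    and deg: "\<And>k. k < r \<Longrightarrow> balanced r a k \<le> d \<and> pvdeg (col L k) = ereal (real (d - balanced r a k)) \<and>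
      pvdeg (row R k) = ereal (real (balanced r a k))"
    unfolding setB_eq_degree_products[OF assms] degree_products_def by blast
  have "pvdeg (col L k) + pvdeg (row R k) = ereal (real d)" if "k < r" for k
  proof -
    have "ereal (real (d - balanced r a k)) + ereal (real (balanced r a k)) = ereal (real d)"
      using deg[OF that] by (simp add: of_nat_diff)
    thus ?thesis using deg[OF that] by metis
  qed
  moreover have "(\<Sum>k<r. pvdeg (row R k)) = (\<Sum>k<r. ereal (real (balanced r a k)))"
    by (rule sum.cong) (use deg in auto)
  hence "(\<Sum>k<r. pvdeg (row R k)) = ereal (real (\<Sum>k<r. balanced r a k))"
    by (simp only: sum_ereal of_nat_sum)
  hence "(\<Sum>k<r. pvdeg (row R k)) = ereal (real a)"
    unfolding sum_balanced[OF assms(1)] .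
  ultimately show "P \<in> setA m n r d a" unfolding setA_def using LR by blast
qed

text \<open>Balancing delivers only upper bounds on degrees, so they are made exact
  afterwards.\<close>

lemma bounded_products_subset_pclosure_setB:
  assumes "m > 0" "n > 0" "r > 0" "(\<Sum>k<r. e k) = a" "a \<le> r * d"
  shows "bounded_products m n r d e \<subseteq> pclosure m n d (setB m n r d a)"
proof -
  have "bounded_products m n r d e \<subseteq> pclosure m n d (bounded_products m n r d (balanced r a))"
    by (rule bounded_products_subset_pclosure_balanced) (simp_all add: sum_balanced assms)
  also have "\<dots> \<subseteq> pclosure m n d (setB m n r d a)"
    unfolding setB_eq_degree_products[OF assms(3,5)]
    by (intro pclosure_minimal le_infI1 bounded_products_subset_pclosure assms)
  finally show ?thesis .
qed

lemma pclosure_setA_eq_setB: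
  assumes "m > 0" "n > 0" "r > 0" "a \<le> r * d"
  shows "pclosure m n d (setB m n r d a) = pclosure m n d (setA m n r d a)"
proof (rule antisym)
  show "pclosure m n d (setA m n r d a) \<subseteq> pclosure m n d (setB m n r d a)"
    using bounded_products_subset_pclosure_setB[OF assms(1-3) _ assms(4)]
    by (intro pclosure_minimal) (blast elim: setA_subset_bounded_products)
qed (intro pclosure_mono setB_subset_setA assms)

section \<open>Minimal factorizations\<close>

text \<open>The bound \<open>f k\<close> on row \<open>k\<close> of \<open>R\<close> is strict, so that \<open>f k = 0\<close> says that the row vanishes.\<close>
definition scaled_factorization ::
  "nat \<Rightarrow> nat \<Rightarrow> nat \<Rightarrow> (nat \<Rightarrow> nat \<Rightarrow> 'a :: field poly) \<Rightarrow> 'a poly \<Rightarrow>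
    (nat \<Rightarrow> nat \<Rightarrow> 'a poly) \<Rightarrow> (nat \<Rightarrow> nat \<Rightarrow> 'a poly) \<Rightarrow> (nat \<Rightarrow> nat) \<Rightarrow> bool" where
  "scaled_factorization m n r P q L R f \<longleftrightarrow> q \<noteq> 0 \<and>
    (\<forall>i<m. \<forall>j<n. q * P i j = (\<Sum>k<r. L i k * R k j)) \<and>
    (\<forall>k<r. \<forall>j<n. \<forall>l\<ge>f k. coeff (R k j) l = 0)"

text \<open>Substituting for row \<open>s\<close> passes its coefficient \<open>L i s\<close> on to
  \<open>S\<close> with factor \<open>\<alpha>\<close> and to the other rows with factors
  \<open>\<beta> k\<close>. The factor \<open>\<alpha>\<close> covers both subtraction of multiples
  of rows (\<open>\<alpha> = 1\<close>) and division by a linear polynomial.\<close>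

lemma scaled_factorization_replace_row:
  fixes \<alpha> :: "'a :: field poly"
  assumes fac: "scaled_factorization m n r P q L R f" and s: "s < r"
    and S: "\<And>j. j < n \<Longrightarrow> R s j = \<alpha> * S j + (\<Sum>k\<in>{..<r} - {s}. \<beta> k * R k j)"
    and bound: "\<And>j l. j < n \<Longrightarrow> l \<ge> f s - 1 \<Longrightarrow> coeff (S j) l = 0"
  shows "\<exists>L'. scaled_factorization m n r P q L' (R(s := S)) (f(s := f s - 1))"
proof -
  define L' where "L' i k = (if k = s then \<alpha> * L i s else L i k + \<beta> k * L i s)" for i k
  have "(\<Sum>k<r. L i k * R k j) = (\<Sum>k<r. L' i k * (R(s := S)) k j)" if "j < n" for i j
  proof -
    have split: "(\<Sum>k<r. h k) = h s + (\<Sum>k\<in>{..<r} - {s}. h k)" for h :: "nat \<Rightarrow> 'a poly"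
      using s by (simp add: sum.remove)
    have "(\<Sum>k<r. L' i k * (R(s := S)) k j) =
        \<alpha> * L i s * S j + (\<Sum>k\<in>{..<r} - {s}. (L i k + \<beta> k * L i s) * R k j)"
      unfolding split by (simp add: L'_def)
    also have "\<dots> = L i s * R s j + (\<Sum>k\<in>{..<r} - {s}. L i k * R k j)"
      unfolding S[OF that] by (simp add: algebra_simps sum.distrib sum_distrib_left)
    finally show ?thesis unfolding split by simp
  qed
  with fac bound have "scaled_factorization m n r P q L' (R(s := S)) (f(s := f s - 1))"
    by (auto simp: scaled_factorization_def)
  thus ?thesis by blast
qed

text \<open>At a scaled factorization with minimal \<open>\<Sum>f\<close> neither the leading coefficient vectors nor
  the values at a point of the nonzero rows are linearly dependent: otherwise the row with the largest
  bound in the dependency could be replaced by one of smaller degree.\<close>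
locale minimal_factorization =
  fixes m n r :: nat and P L R :: "nat \<Rightarrow> nat \<Rightarrow> 'a :: field poly" and q f
  assumes fac: "scaled_factorization m n r P q L R f"
    and minimal: "\<And>q L R f'. scaled_factorization m n r P q L R f' \<Longrightarrow> (\<Sum>k<r. f k) \<le> (\<Sum>k<r. f' k)"
begin

lemma coeff_eq_0_bound: "k < r \<Longrightarrow> j < n \<Longrightarrow> f k \<le> l \<Longrightarrow> coeff (R k j) l = 0"
  using fac by (simp add: scaled_factorization_def)

text \<open>The replacement would have a smaller sum of bounds; \<open>f s > 0\<close> makes the
  decrease strict.\<close>

lemma row_irreplaceable:
  assumes s: "s < r" "f s > 0"
    and S: "\<And>j. j < n \<Longrightarrow> R s j = \<alpha> * S j + (\<Sum>k\<in>{..<r} - {s}. \<beta> k * R k j)"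
    and bound: "\<And>j l. j < n \<Longrightarrow> l \<ge> f s - 1 \<Longrightarrow> coeff (S j) l = 0"
  shows False
proof -
  obtain L' where "scaled_factorization m n r P q L' (R(s := S)) (f(s := f s - 1))"
    using scaled_factorization_replace_row[OF fac s(1) S bound] by blast
  from minimal[OF this] have "(\<Sum>k<r. f k) \<le> (\<Sum>k<r. (f(s := f s - 1)) k)" .
  also have "\<dots> < (\<Sum>k<r. f k)"
    by (rule sum_strict_mono_ex1) (use s in auto)
  finally show False by simp
qed

lemma obtain_dependent_row:
  fixes c :: "nat \<Rightarrow> 'a"
  assumes "k0 < r" "c k0 \<noteq> 0" "\<And>k. k < r \<Longrightarrow> f k = 0 \<Longrightarrow> c k = 0"
  obtains s where "s < r" "c s \<noteq> 0" "f s > 0" "\<And>k. k < r \<Longrightarrow> c k \<noteq> 0 \<Longrightarrow> f k \<le> f s"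
proof -
  let ?K = "{k. k < r \<and> c k \<noteq> 0}"
  have fin: "finite (f ` ?K)" and ne: "f ` ?K \<noteq> {}" using assms by auto
  from Max_in[OF fin ne] obtain s where s: "s \<in> ?K" "f s = Max (f ` ?K)" by auto
  show thesis
  proof (rule that)
    show "f k \<le> f s" if "k < r" "c k \<noteq> 0" for k
      unfolding s(2) by (rule Max_ge) (use fin that in auto)
    show "f s > 0" using s(1) assms(3)[of s] by auto
  qed (use s in auto)
qed

text \<open>Bounds are strict, so the leading coefficient of row \<open>k\<close> sits at
  \<open>f k - 1\<close>. Multiplying row \<open>k\<close> by a power of the variable aligns it with
  row \<open>s\<close> of largest bound, and the dependency then cancels the coefficient at
  \<open>f s - 1\<close>.\<close>

lemma leading_coeffs_independent:
  assumes dep: "\<And>j. j < n \<Longrightarrow> (\<Sum>k<r. c k * coeff (R k j) (f k - 1)) = 0"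
    and supp: "\<And>k. k < r \<Longrightarrow> f k = 0 \<Longrightarrow> c k = 0" and "k < r"
  shows "c k = 0"
proof (rule ccontr)
  assume "c k \<noteq> 0"
  with obtain_dependent_row[of k c] supp \<open>k < r\<close> obtain s where s: "s < r" "c s \<noteq> 0" "f s > 0"
    and smax: "\<And>k. k < r \<Longrightarrow> c k \<noteq> 0 \<Longrightarrow> f k \<le> f s" by blast
  \<comment> \<open>The difference \<open>f s - f k\<close> is truncated only when
    \<open>c k = 0\<close>, and then \<open>\<beta> k = 0\<close>.\<close>
  define \<beta> where "\<beta> k = monom (- c k / c s) (f s - f k)" for k
  define S where "S j = R s j - (\<Sum>k\<in>{..<r} - {s}. \<beta> k * R k j)" for j
  \<comment> \<open>From \<open>f k > 0\<close> follows
    \<open>f s - f k \<le> f s - 1 \<le> l\<close>, so the shifted index stays in range.\<close>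
  have coeff_\<beta>: "coeff (\<beta> k * R k j) l = - (c k / c s) * coeff (R k j) (l - (f s - f k))"
    if "k < r" "j < n" "l \<ge> f s - 1" for k j l
  proof (cases "c k = 0")
    case False
    hence "f k > 0" using supp[OF that(1)] by auto
    thus ?thesis using that by (simp add: \<beta>_def coeff_monom_mult)
  qed (simp add: \<beta>_def)
  show False
  proof (rule row_irreplaceable[OF s(1,3)])
    show "R s j = 1 * S j + (\<Sum>k\<in>{..<r} - {s}. \<beta> k * R k j)" for j
      by (simp add: S_def)
    fix j l assume j: "j < n" and l: "l \<ge> f s - 1"
    show "coeff (S j) l = 0"
    proof (cases "l = f s - 1")
      case True
      have "coeff (\<beta> k * R k j) l = - (c k * coeff (R k j) (f k - 1)) / c s" if "k < r" for k
      proof (cases "c k = 0")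
        case False
        hence "f s - 1 - (f s - f k) = f k - 1" using smax[OF that] supp[OF that] s(3) by force
        thus ?thesis using coeff_\<beta>[OF that j l] True by simp
      qed (simp add: \<beta>_def)
      hence "coeff (\<Sum>k\<in>{..<r} - {s}. \<beta> k * R k j) l =
          - (\<Sum>k\<in>{..<r} - {s}. c k * coeff (R k j) (f k - 1)) / c s"
        by (simp add: coeff_sum sum_negf sum_divide_distrib)
      also have "(\<Sum>k\<in>{..<r} - {s}. c k * coeff (R k j) (f k - 1)) = - (c s * coeff (R s j) (f s - 1))"
        using dep[OF j] s(1) by (simp add: sum.remove[of _ s] add_eq_0_iff)
      finally show ?thesis using True s(2) by (simp add: S_def)
    next
      case False
      have "coeff (\<beta> k * R k j) l = 0" if "k < r" for k
      proof (cases "c k = 0")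
        case ck: False
        hence "f k \<le> l - (f s - f k)" using smax[OF that] False l by force
        thus ?thesis using coeff_\<beta>[OF that j l] coeff_eq_0_bound[OF that j] by simp
      qed (simp add: \<beta>_def)
      moreover have "coeff (R s j) l = 0" using coeff_eq_0_bound[OF s(1) j] False l by simp
      ultimately show ?thesis by (simp add: S_def coeff_sum)
    qed
  qed
qed

text \<open>A combination of rows vanishing at \<open>x\<close> is divisible by the linear
  polynomial with root \<open>x\<close>. The quotient has smaller degree and can replace the row of
  largest bound in the combination.\<close>

lemma values_independent:
  assumes dep: "\<And>j. j < n \<Longrightarrow> (\<Sum>k<r. c k * poly (R k j) x) = 0"
    and supp: "\<And>k. k < r \<Longrightarrow> f k = 0 \<Longrightarrow> c k = 0" and "k < r"
  shows "c k = 0"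
proof (rule ccontr)
  assume "c k \<noteq> 0"
  with obtain_dependent_row[of k c] supp \<open>k < r\<close> obtain s where s: "s < r" "c s \<noteq> 0" "f s > 0"
    and smax: "\<And>k. k < r \<Longrightarrow> c k \<noteq> 0 \<Longrightarrow> f k \<le> f s" by blast
  define T where "T j = (\<Sum>k<r. [:c k / c s:] * R k j)" for j
  define S where "S j = T j div [:-x, 1:]" for j
  have T: "T j = [:-x, 1:] * S j" if "j < n" for j
  proof -
    have "poly (T j) x = (\<Sum>k<r. c k * poly (R k j) x) / c s"
      by (simp add: T_def poly_sum sum_divide_distrib)
    hence "[:-x, 1:] dvd T j" using dep[OF that] by (simp add: poly_eq_0_iff_dvd)
    thus ?thesis unfolding S_def by (rule dvd_mult_div_cancel[symmetric])
  qed
  show False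
  proof (rule row_irreplaceable[OF s(1,3)])
    fix j assume j: "j < n"
    have "T j = R s j + (\<Sum>k\<in>{..<r} - {s}. [:c k / c s:] * R k j)"
      using s by (simp add: T_def sum.remove[of _ s])
    thus "R s j = [:-x, 1:] * S j + (\<Sum>k\<in>{..<r} - {s}. [:- c k / c s:] * R k j)"
      unfolding T[OF j, symmetric] by (simp add: sum_negf)
    have "coeff (T j) l = 0" if "l \<ge> f s" for l
      unfolding T_def coeff_sum
    proof (rule sum.neutral, rule ballI)
      fix k assume "k \<in> {..<r}"
      thus "coeff ([:c k / c s:] * R k j) l = 0"
        using coeff_eq_0_bound[of k j l] smax[of k] that j by (cases "c k = 0") auto
    qed
    \<comment> \<open>Entries of \<open>T\<close> have degree below \<open>f s\<close>; dividing out
      one linear factor leaves degree below \<open>f s - 1\<close>.\<close>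
    moreover have "degree (T j) = Suc (degree (S j))" if "S j \<noteq> 0"
      unfolding T[OF j] using that by (subst degree_mult_eq) auto
    ultimately have "degree (S j) < f s - 1" if "S j \<noteq> 0"
      using that T[OF j] s(3) by (metis (no_types, lifting) Suc_lessD leading_coeff_0_iff less_diff_conv
        Suc_eq_plus1 degree_0 mult_eq_0_iff nat.distinct(1) not_less)
    thus "coeff (S j) l = 0" if "l \<ge> f s - 1" for l
      using that by (cases "S j = 0") (auto intro: coeff_eq_0)
  qed
qed

text \<open>Predictable degree property for one row \<open>p\<close> of the matrix. If the largest
  value \<open>M\<close> of \<open>degree (l k) + (f k - 1)\<close> exceeded \<open>d\<close>, the
  coefficients of \<open>p\<close> at \<open>M\<close> would vanish and give a dependency among
  leading coefficient vectors.\<close>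

lemma degree_bound:
  assumes PLR: "\<And>j. j < n \<Longrightarrow> p j = (\<Sum>k<r. l k * R k j)"
    and supp: "\<And>k. k < r \<Longrightarrow> f k = 0 \<Longrightarrow> l k = 0"
    and deg: "\<And>j. j < n \<Longrightarrow> degree (p j) \<le> d"
    and k: "k < r" "l k \<noteq> 0"
  shows "degree (l k) + (f k - 1) \<le> d"
proof (rule ccontr)
  assume contra: "\<not> ?thesis"
  let ?g = "\<lambda>k. degree (l k) + (f k - 1)"
  let ?K = "{k. k < r \<and> l k \<noteq> 0}"
  define M where "M = Max (?g ` ?K)"
  have fin: "finite (?g ` ?K)" and ne: "?g ` ?K \<noteq> {}" using k by auto
  from Max_in[OF fin ne] obtain s where s: "s < r" "l s \<noteq> 0" "M = ?g s" unfolding M_def by auto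
  have le_M: "?g k \<le> M" if "k < r" "l k \<noteq> 0" for k
    unfolding M_def by (rule Max_ge) (use fin that in auto)
  have "M > d" using le_M[OF k] contra by simp
  \<comment> \<open>This is the leading coefficient of \<open>l k\<close> if \<open>k\<close>
    attains \<open>M\<close>, and 0 otherwise.\<close>
  define c where "c k = coeff (l k) (M - (f k - 1))" for k
  have coeff_M: "coeff (l k * R k j) M = c k * coeff (R k j) (f k - 1)" if "k < r" "j < n" for k j
  proof (cases "l k = 0")
    case False
    hence fk: "f k > 0" and gk: "degree (l k) \<le> M - (f k - 1)" "f k - 1 \<le> M"
      using supp[of k] le_M[of k] that by auto
    have "coeff (l k * R k j) M = (\<Sum>i\<le>M. coeff (l k) i * coeff (R k j) (M - i))"
      by (rule coeff_mult)
    \<comment> \<open>For smaller \<open>i\<close> the index \<open>M - i\<close> reaches the bound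
      \<open>f k\<close>; for larger \<open>i\<close> it is \<open>l k\<close> whose coefficient
      vanishes.\<close>
    also have "\<dots> = (\<Sum>i\<in>{M - (f k - 1)}. coeff (l k) i * coeff (R k j) (M - i))"
    proof (rule sum.mono_neutral_right)
      show "\<forall>i\<in>{..M} - {M - (f k - 1)}. coeff (l k) i * coeff (R k j) (M - i) = 0"
      proof
        fix i assume i: "i \<in> {..M} - {M - (f k - 1)}"
        show "coeff (l k) i * coeff (R k j) (M - i) = 0"
        proof (cases "i < M - (f k - 1)")
          case True
          hence "f k \<le> M - i" using fk by linarith
          thus ?thesis using coeff_eq_0_bound[OF that] by simp
        next
          case False
          hence "degree (l k) < i" using gk i by simp
          thus ?thesis by (simp add: coeff_eq_0)
        qed
      qed
    qed auto
    also have "\<dots> = c k * coeff (R k j) (f k - 1)" using gk by (simp add: c_def)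
    finally show ?thesis .
  qed (simp add: c_def)
  have "(\<Sum>k<r. c k * coeff (R k j) (f k - 1)) = 0" if "j < n" for j
  proof -
    have "(\<Sum>k<r. c k * coeff (R k j) (f k - 1)) = coeff (p j) M"
      unfolding PLR[OF that] coeff_sum using coeff_M that by simp
    also have "\<dots> = 0" using deg[OF that] \<open>M > d\<close> by (intro coeff_eq_0) simp
    finally show ?thesis .
  qed
  hence "c s = 0"
    by (rule leading_coeffs_independent) (use supp s in \<open>auto simp: c_def\<close>)
  thus False using s by (simp add: c_def)
qed

end

text \<open>At \<open>x\<close> the left side vanishes, so independence of the row values forces
  every \<open>L' i k\<close> to vanish there; the linear factor then cancels.\<close>

lemma (in minimal_factorization) divide_scalar:
  fixes x :: 'a
  assumes fac: "\<And>i j. i < m \<Longrightarrow> j < n \<Longrightarrow> ([:-x, 1:] * q') * P i j = (\<Sum>k<r. L' i k * R k j)"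
    and supp: "\<And>i k. i < m \<Longrightarrow> k < r \<Longrightarrow> f k = 0 \<Longrightarrow> L' i k = 0"
  shows "i < m \<Longrightarrow> j < n \<Longrightarrow> q' * P i j = (\<Sum>k<r. (L' i k div [:-x, 1:]) * R k j)"
proof -
  assume ij: "i < m" "j < n"
  have root: "poly (L' i k) x = 0" if "k < r" for k
  proof (rule values_independent[OF _ _ that, of "\<lambda>k. poly (L' i k) x"])
    fix j assume "j < n"
    from arg_cong[OF fac[OF ij(1) this], of "\<lambda>p. poly p x"]
    show "(\<Sum>k<r. poly (L' i k) x * poly (R k j) x) = 0" by (simp add: poly_sum)
  qed (use supp ij in auto)
  have L': "L' i k = [:-x, 1:] * (L' i k div [:-x, 1:])" if "k < r" for k
    by (rule dvd_mult_div_cancel[symmetric]) (use root[OF that] in \<open>simp add: poly_eq_0_iff_dvd\<close>)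
  have "[:-x, 1:] * (q' * P i j) = (\<Sum>k<r. L' i k * R k j)"
    using fac[OF ij] by (simp only: mult.assoc)
  also have "\<dots> = (\<Sum>k<r. [:-x, 1:] * (L' i k div [:-x, 1:]) * R k j)"
    by (rule sum.cong) (use L' in auto)
  also have "\<dots> = [:-x, 1:] * (\<Sum>k<r. (L' i k div [:-x, 1:]) * R k j)"
    by (simp only: sum_distrib_left mult.assoc)
  finally show ?thesis by (subst (asm) mult_left_cancel) auto
qed

text \<open>Induction on the degree of \<open>q'\<close>, dividing out one root at a time. Only
  \<open>q'\<close> and the left factor change, so the independence properties of \<open>R\<close>
  remain available.\<close>

lemma (in minimal_factorization) remove_scalar:
  assumes alg_closed: "\<And>p :: 'a poly. degree p > 0 \<Longrightarrow> \<exists>x. poly p x = 0"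
  assumes "q' \<noteq> 0" "\<And>i j. i < m \<Longrightarrow> j < n \<Longrightarrow> q' * P i j = (\<Sum>k<r. L' i k * R k j)"
    "\<And>i k. i < m \<Longrightarrow> k < r \<Longrightarrow> f k = 0 \<Longrightarrow> L' i k = 0"
  shows "\<exists>L''. (\<forall>i<m. \<forall>j<n. P i j = (\<Sum>k<r. L'' i k * R k j)) \<and>
    (\<forall>i<m. \<forall>k<r. f k = 0 \<longrightarrow> L'' i k = 0)"
  using assms(2-)
proof (induction "degree q'" arbitrary: q' L')
  case 0
  then obtain a where a: "q' = [:a:]" by (metis degree_eq_zeroE)
  with 0 have "a \<noteq> 0" by auto
  have "P i j = (\<Sum>k<r. ([:1/a:] * L' i k) * R k j)" if "i < m" "j < n" for i j
  proof -
    have "P i j = [:1/a:] * (q' * P i j)" using \<open>a \<noteq> 0\<close> by (simp add: a)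
    thus ?thesis unfolding 0(3)[OF that] by (simp only: sum_distrib_left mult.assoc)
  qed
  thus ?case using 0(4) by (intro exI[of _ "\<lambda>i k. [:1/a:] * L' i k"]) auto
next
  case (Suc N)
  then obtain x where "poly q' x = 0" using alg_closed[of q'] by auto
  then obtain q2 where q2: "q' = [:-x, 1:] * q2" by (auto simp: poly_eq_0_iff_dvd)
  with Suc have nz: "q2 \<noteq> 0" by auto
  hence "degree q' = Suc (degree q2)" unfolding q2 by (subst degree_mult_eq) auto
  with Suc(2) have "N = degree q2" by simp
  show ?case
  proof (rule Suc(1)[OF \<open>N = degree q2\<close> nz])
    show "q2 * P i j = (\<Sum>k<r. (L' i k div [:-x, 1:]) * R k j)" if "i < m" "j < n" for i j
      using divide_scalar[OF Suc(4)[unfolded q2] Suc(5) that] .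
    show "L' i k div [:-x, 1:] = 0" if "i < m" "k < r" "f k = 0" for i k
      using Suc(5)[OF that] by simp
  qed
qed

text \<open>Forney: with a minimal basis \<open>R\<close> of the row space, the predictable degree property bounds
  the degree of the rows of the left factor.\<close>
lemma factorization_with_degrees:
  fixes P :: "nat \<Rightarrow> nat \<Rightarrow> 'a :: field poly" and m n r d :: nat
  assumes alg_closed: "\<And>p :: 'a poly. degree p > 0 \<Longrightarrow> \<exists>x. poly p x = 0"
    and q: "q \<noteq> 0" "\<And>i j. i < m \<Longrightarrow> j < n \<Longrightarrow> q * P i j = (\<Sum>k<r. L i k * R k j)"
    and deg: "\<And>i j. i < m \<Longrightarrow> j < n \<Longrightarrow> degree (P i j) \<le> d"
  obtains u v e where
    "\<And>k. k < r \<Longrightarrow> e k \<le> d"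
    "\<And>i k. i < m \<Longrightarrow> k < r \<Longrightarrow> degree (u i k) + e k \<le> d"
    "\<And>k j. k < r \<Longrightarrow> j < n \<Longrightarrow> degree (v k j) \<le> e k"
    "\<And>i j. i < m \<Longrightarrow> j < n \<Longrightarrow> P i j = (\<Sum>k<r. u i k * v k j)"
proof -
  \<comment> \<open>A crude strict bound, just to have some scaled factorization to minimize
    from.\<close>
  define f where "f k = Suc (\<Sum>j<n. degree (R k j))" for k
  have "coeff (R k j) l = 0" if "j < n" "f k \<le> l" for k j l
  proof (rule coeff_eq_0)
    have "degree (R k j) \<le> (\<Sum>j<n. degree (R k j))" by (rule member_le_sum) (use that in auto)
    thus "degree (R k j) < l" using that(2) by (simp add: f_def)
  qed
  hence "scaled_factorization m n r P q L R f" using q by (simp add: scaled_factorization_def)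
  hence ex: "\<exists>N q L R f. scaled_factorization m n r P q L R f \<and> (\<Sum>k<r. f k) = N" by blast
  define N where "N = (LEAST N. \<exists>q L R f. scaled_factorization m n r P q L R f \<and> (\<Sum>k<r. f k) = N)"
  from LeastI_ex[OF ex] obtain q0 L0 R0 f0
    where fac0: "scaled_factorization m n r P q0 L0 R0 f0" and sum0: "(\<Sum>k<r. f0 k) = N"
    unfolding N_def by blast
  interpret minimal_factorization m n r P L0 R0 q0 f0
  proof
    fix q L R f assume "scaled_factorization m n r P q L R f"
    thus "(\<Sum>k<r. f0 k) \<le> (\<Sum>k<r. f k)"
      unfolding sum0 N_def by (intro Least_le) blast
  qed (rule fac0)
  \<comment> \<open>Rows with bound 0 vanish, so the columns facing them may be zeroed; this
    supplies the support condition of \<open>remove_scalar\<close> and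
    \<open>degree_bound\<close>.\<close>
  define L1 where "L1 i k = (if f0 k = 0 then 0 else L0 i k)" for i k
  have "q0 * P i j = (\<Sum>k<r. L1 i k * R0 k j)" if "i < m" "j < n" for i j
  proof -
    have "q0 * P i j = (\<Sum>k<r. L0 i k * R0 k j)"
      using fac0 that by (simp add: scaled_factorization_def)
    also have "\<dots> = (\<Sum>k<r. L1 i k * R0 k j)"
    proof (rule sum.cong)
      fix k assume "k \<in> {..<r}"
      hence "R0 k j = 0" if "f0 k = 0"
        using coeff_eq_0_bound[of k j] \<open>j < n\<close> that by (intro poly_eqI) simp
      thus "L0 i k * R0 k j = L1 i k * R0 k j" by (simp add: L1_def)
    qed simp
    finally show ?thesis .
  qed
  moreover have "q0 \<noteq> 0" using fac0 by (simp add: scaled_factorization_def)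
  ultimately obtain u where u: "\<And>i j. i < m \<Longrightarrow> j < n \<Longrightarrow> P i j = (\<Sum>k<r. u i k * R0 k j)"
    and supp: "\<And>i k. i < m \<Longrightarrow> k < r \<Longrightarrow> f0 k = 0 \<Longrightarrow> u i k = 0"
    using remove_scalar[OF alg_closed, of q0 L1] by (auto simp: L1_def)
  have deg_u: "degree (u i k) + (f0 k - 1) \<le> d" if "i < m" "k < r" "u i k \<noteq> 0" for i k
    by (rule degree_bound[of "P i" "u i"]) (use that u supp deg in auto)
  \<comment> \<open>If \<open>f0 k - 1\<close> exceeds \<open>d\<close>, then \<open>deg_u\<close>
    forces column \<open>k\<close> of \<open>u\<close> to be zero, and row \<open>k\<close> can be
    replaced by zero with bound 0.\<close>
  define e where "e k = (if f0 k - 1 \<le> d then f0 k - 1 else 0)" for k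
  define v where "v k j = (if f0 k - 1 \<le> d then R0 k j else 0)" for k j
  show thesis
  proof (rule that[of e u v])
    show "e k \<le> d" for k by (simp add: e_def)
    show "degree (u i k) + e k \<le> d" if "i < m" "k < r" for i k
      using deg_u[OF that] by (cases "u i k = 0") (auto simp: e_def)
    show "degree (v k j) \<le> e k" if "k < r" "j < n" for k j
    proof (cases "f0 k - 1 \<le> d")
      case True
      have "degree (R0 k j) \<le> f0 k - 1"
        by (rule degree_le) (use coeff_eq_0_bound[OF that] in auto)
      with True show ?thesis by (simp add: v_def e_def)
    qed (simp add: v_def)
    show "P i j = (\<Sum>k<r. u i k * v k j)" if "i < m" "j < n" for i j
      unfolding u[OF that]
    proof (rule sum.cong)
      fix k assume "k \<in> {..<r}"
      thus "u i k * R0 k j = u i k * v k j"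
        using deg_u[OF that(1), of k] by (cases "u i k = 0") (auto simp: v_def)
    qed simp
  qed
qed

section \<open>Rank and factorizations\<close>

text \<open>Padding the left factor with a zero column makes both factors square, and the padded one
  has determinant 0.\<close>

lemma det_low_inner_dimension:
  fixes X Y :: "nat \<Rightarrow> nat \<Rightarrow> 'a :: comm_ring_1"
  shows "Determinant.det (Matrix.mat (Suc r) (Suc r) (\<lambda>(i,j). \<Sum>k<r. X i k * Y k j)) = 0"
proof -
  define X' where "X' = Matrix.mat (Suc r) (Suc r) (\<lambda>(i,k). if k < r then X i k else 0)"
  define Y' where "Y' = Matrix.mat (Suc r) (Suc r) (\<lambda>(k,j). Y k j)"
  have "Matrix.mat (Suc r) (Suc r) (\<lambda>(i,j). \<Sum>k<r. X i k * Y k j) = X' * Y'"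
    by (rule eq_matI) (auto simp: X'_def Y'_def scalar_prod_def atLeast0LessThan)
  moreover have "Determinant.det (X' * Y') = Determinant.det X' * Determinant.det Y'"
    by (rule det_mult[of _ "Suc r"]) (simp_all add: X'_def Y'_def)
  moreover have "Determinant.det X' = (\<Sum>i<Suc r. X' $$ (i,r) * cofactor X' i r)"
    by (rule laplace_expansion_column) (simp_all add: X'_def)
  hence "Determinant.det X' = 0" by (simp add: X'_def)
  ultimately show ?thesis by simp
qed

text \<open>Schur complement: a pivot \<open>A i0 j0\<close> reduces the claim to the matrix obtained by one step of
  Gaussian elimination.\<close>
lemma factorization_or_minor:
  fixes A :: "nat \<Rightarrow> nat \<Rightarrow> 'a :: field"
  shows "(\<exists>X Y. \<forall>i<m. \<forall>j<n. A i j = (\<Sum>k<r. X i k * Y k j)) \<or>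
    (\<exists>f g. (\<forall>k<Suc r. f k < m \<and> g k < n) \<and>
      Determinant.det (Matrix.mat (Suc r) (Suc r) (\<lambda>(k,l). A (f k) (g l))) \<noteq> 0)"
proof (induction r arbitrary: A)
  case 0
  show ?case
  proof (cases "\<forall>i<m. \<forall>j<n. A i j = 0")
    case False
    then obtain i j where ij: "i < m" "j < n" "A i j \<noteq> 0" by blast
    have "Determinant.det (Matrix.mat (Suc 0) (Suc 0) (\<lambda>_. A i j)) = A i j"
      by (subst det_single) auto
    with ij show ?thesis by (intro disjI2) (rule exI[of _ "\<lambda>_. i"], rule exI[of _ "\<lambda>_. j"], simp)
  qed auto
next
  case (Suc r)
  show ?case
  proof (cases "\<forall>i<m. \<forall>j<n. A i j = 0")
    case True
    thus ?thesis by (intro disjI1 exI[of _ "\<lambda>_ _. 0"]) auto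
  next
    case False
    then obtain i0 j0 where ij0: "i0 < m" "j0 < n" "A i0 j0 \<noteq> 0" by blast
    define p where "p = A i0 j0"
    define A' where "A' i j = A i j - A i j0 / p * A i0 j" for i j
    from Suc[of A'] show ?thesis
    proof (elim disjE exE conjE)
      fix X Y assume XY: "\<forall>i<m. \<forall>j<n. A' i j = (\<Sum>k<r. X i k * Y k j)"
      define X' where "X' i k = (if k = r then A i j0 / p else X i k)" for i k
      define Y' where "Y' k j = (if k = r then A i0 j else Y k j)" for k j
      have "A i j = (\<Sum>k<Suc r. X' i k * Y' k j)" if "i < m" "j < n" for i j
      proof -
        have "(\<Sum>k<r. X' i k * Y' k j) = A' i j" using XY that by (simp add: X'_def Y'_def)
        thus ?thesis by (simp add: X'_def Y'_def A'_def)
      qed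
      thus ?thesis by blast
    next
      fix f' g' assume fg': "\<forall>k<Suc r. f' k < m \<and> g' k < n"
        and det': "Determinant.det (Matrix.mat (Suc r) (Suc r) (\<lambda>(k,l). A' (f' k) (g' l))) \<noteq> 0"
      define f g where "f = case_nat i0 f'" and "g = case_nat j0 g'"
      define N where "N = Suc (Suc r)"
      define M where "M = Matrix.mat N N (\<lambda>(k,l). A (f k) (g l))"
      \<comment> \<open>Left multiplication by \<open>E\<close> clears column 0 below the pivot. The
        value of its determinant is immaterial: a nonzero determinant of \<open>E * M\<close>
        already forces that of \<open>M\<close> to be nonzero.\<close>
      define E where "E = Matrix.mat N N
        (\<lambda>(k,l). if k = l then 1 else if l = 0 then - A (f k) j0 / p else 0)"
      have EM: "(E * M) $$ (k,l) = (if k = 0 then A i0 (g l) else A' (f k) (g l))"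
        if "k < N" "l < N" for k l
      proof -
        have "(E * M) $$ (k,l) = (\<Sum>t<N. E $$ (k,t) * M $$ (t,l))"
          using that by (simp add: E_def M_def scalar_prod_def atLeast0LessThan)
        also have "\<dots> = (\<Sum>t\<in>{0,k}. E $$ (k,t) * M $$ (t,l))"
          by (rule sum.mono_neutral_right) (use that in \<open>auto simp: E_def\<close>)
        also have "\<dots> = (if k = 0 then A i0 (g l) else A' (f k) (g l))"
          using that by (cases "k = 0") (auto simp: E_def M_def A'_def f_def)
        finally show ?thesis .
      qed
      have dims: "E \<in> carrier_mat N N" "M \<in> carrier_mat N N" by (simp_all add: E_def M_def)
      have "Determinant.det (E * M) = (\<Sum>k<N. (E * M) $$ (k,0) * cofactor (E * M) k 0)"
        by (rule laplace_expansion_column) (use dims in \<open>auto simp: N_def\<close>)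
      also have "\<dots> = (\<Sum>k\<in>{0}. (E * M) $$ (k,0) * cofactor (E * M) k 0)"
      proof (rule sum.mono_neutral_right)
        show "\<forall>k\<in>{..<N} - {0}. (E * M) $$ (k,0) * cofactor (E * M) k 0 = 0"
        proof
          fix k assume k: "k \<in> {..<N} - {0}"
          hence "(E * M) $$ (k,0) = A' (f k) j0" using EM[of k 0] by (simp add: N_def g_def)
          also have "\<dots> = 0" using ij0 by (simp add: A'_def p_def)
          finally show "(E * M) $$ (k,0) * cofactor (E * M) k 0 = 0" by simp
        qed
      qed (auto simp: N_def)
      also have "\<dots> = p * Determinant.det (mat_delete (E * M) 0 0)"
        using EM[of 0 0] by (simp add: cofactor_def N_def g_def p_def)
      also have "mat_delete (E * M) 0 0 = Matrix.mat (Suc r) (Suc r) (\<lambda>(k,l). A' (f' k) (g' l))"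
      proof (rule eq_matI)
        fix k l assume kl: "k < dim_row (Matrix.mat (Suc r) (Suc r) (\<lambda>(k,l). A' (f' k) (g' l)))"
          "l < dim_col (Matrix.mat (Suc r) (Suc r) (\<lambda>(k,l). A' (f' k) (g' l)))"
        hence "mat_delete (E * M) 0 0 $$ (k,l) = (E * M) $$ (Suc k, Suc l)"
          using dims by (simp add: mat_delete_def N_def)
        also have "\<dots> = A' (f' k) (g' l)" using EM[of "Suc k" "Suc l"] kl by (simp add: N_def f_def g_def)
        finally show "mat_delete (E * M) 0 0 $$ (k,l) =
          Matrix.mat (Suc r) (Suc r) (\<lambda>(k,l). A' (f' k) (g' l)) $$ (k,l)" using kl by simp
      qed (use dims in \<open>simp_all add: N_def\<close>)
      finally have "Determinant.det (E * M) \<noteq> 0" using det' ij0 by (simp add: p_def)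
      hence "Determinant.det M \<noteq> 0" using det_mult[OF dims] by auto
      moreover have "\<forall>k<Suc (Suc r). f k < m \<and> g k < n"
        using fg' ij0 by (auto simp: f_def g_def split: nat.split)
      ultimately show ?thesis unfolding M_def N_def by blast
    qed
  qed
qed

text \<open>Subadditivity of rank, peeling off one rank-one term at a time.\<close>

lemma (in vec_space) rank_le_of_factorization:
  assumes "A \<in> carrier_mat n nc"
    and "\<And>i j. i < n \<Longrightarrow> j < nc \<Longrightarrow> A $$ (i,j) = (\<Sum>k<r. X i k * Y k j)"
  shows "rank A \<le> r"
  using assms
proof (induction r arbitrary: A)
  case 0
  hence "A = 0\<^sub>m n nc" by (intro eq_matI) auto
  thus ?case by (simp add: rank_0I)
next
  case (Suc r)
  define B where "B = Matrix.mat n nc (\<lambda>(i,j). \<Sum>k<r. X i k * Y k j)"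
  define C where "C = Matrix.mat n nc (\<lambda>(i,j). X i r * Y r j)"
  have BC: "B \<in> carrier_mat n nc" "C \<in> carrier_mat n nc" by (simp_all add: B_def C_def)
  have "rank B \<le> r" by (rule Suc.IH[OF BC(1)]) (simp add: B_def)
  moreover have "rank C \<le> 1"
    by (rule rank_le_1_product_entries[OF BC(2), of "\<lambda>i. X i r" "Y r"]) (simp add: C_def)
  moreover have "A = B + C" using Suc.prems by (intro eq_matI) (auto simp: B_def C_def)
  ultimately show ?case using rank_subadditive[OF BC] by simp
qed

text \<open>A maximal independent set \<open>S\<close> of columns spans all columns and has
  \<open>rank A\<close> elements. These, enumerated by \<open>h\<close>, are the columns of
  \<open>X\<close>; the coordinates form \<open>Y\<close>, padded with zeros up to
  \<open>r\<close>.\<close>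

lemma (in vec_space) factorization_of_rank_le:
  assumes A: "A \<in> carrier_mat n nc" and r: "rank A \<le> r"
  obtains X Y where "\<And>i j. i < n \<Longrightarrow> j < nc \<Longrightarrow> A $$ (i,j) = (\<Sum>k<r. X i k * Y k j)"
proof -
  obtain S where S: "maximal S (\<lambda>T. T \<subseteq> set (cols A) \<and> lin_indpt T)"
    using maximal_exists[of "(\<lambda>T. T \<subseteq> set (cols A) \<and> lin_indpt T)" "card (set (cols A))" "{}"]
    by (meson List.finite_set card_mono empty_iff empty_subsetI finite_lin_indpt2 rev_finite_subset)
  have cols: "set (cols A) \<subseteq> carrier_vec n" using A cols_dim by blast
  have S_sub: "S \<subseteq> set (cols A)" and ind: "lin_indpt S" using S by (auto simp: maximal_def)
  have fin: "finite S" using S_sub by (rule finite_subset) simp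
  have SC: "S \<subseteq> carrier_vec n" using S_sub cols by blast
  have card: "card S \<le> r" using rank_card_indpt[OF A S] r by simp
  have "col A j \<in> span S" if "j < nc" for j
  proof (cases "col A j \<in> S")
    case True
    thus ?thesis using in_own_span SC by auto
  next
    case False
    have cj: "col A j \<in> set (cols A)" using that A by (metis carrier_matD(2) cols_length cols_nth nth_mem)
    show ?thesis
    proof (rule ccontr)
      assume "col A j \<notin> span S"
      hence "lin_indpt (S \<union> {col A j})"
        using lin_dep_iff_in_span[of S "col A j"] SC ind False cj cols by auto
      hence "S \<union> {col A j} = S" using S S_sub cj unfolding maximal_def by blast
      thus False using False by blast
    qed
  qed
  hence "\<exists>a. col A j = lincomb a S" if "j < nc" for j
    using that finite_span[OF fin] SC by auto
  then obtain a where a: "\<And>j. j < nc \<Longrightarrow> col A j = lincomb (a j) S" by metis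
  obtain h where h: "bij_betw h {0..<card S} S" using ex_bij_betw_nat_finite[OF fin] by blast
  show thesis
  proof
    fix i j assume ij: "i < n" "j < nc"
    have "A $$ (i,j) = col A j $ i" using ij A by simp
    also have "\<dots> = (\<Sum>s\<in>S. a j s * s $ i)" using a[OF ij(2)] lincomb_index[OF ij(1) SC] by simp
    also have "\<dots> = (\<Sum>k\<in>{0..<card S}. a j (h k) * h k $ i)"
      by (rule sum.reindex_bij_betw[OF h, symmetric])
    also have "\<dots> = (\<Sum>k<r. if k < card S then a j (h k) * h k $ i else 0)"
      by (rule sum.mono_neutral_cong_left) (use card in auto)
    also have "\<dots> = (\<Sum>k<r. h k $ i * (if k < card S then a j (h k) else 0))"
      by (rule sum.cong) (auto simp: mult.commute)
    finally show "A $$ (i,j) = (\<Sum>k<r. h k $ i * (if k < card S then a j (h k) else 0))" .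
  qed
qed

section \<open>Clearing denominators, and normal rank as inner dimension of a factorization\<close>

lemma common_denominator:
  fixes S :: "'a :: idom fract set"
  assumes "finite S"
  shows "\<exists>q. q \<noteq> 0 \<and> (\<forall>x\<in>S. \<exists>a. to_fract q * x = to_fract a)"
  using assms
proof induction
  case empty
  show ?case by (rule exI[of _ 1]) simp
next
  case (insert x S)
  then obtain q where q: "q \<noteq> 0" "\<And>y. y \<in> S \<Longrightarrow> \<exists>a. to_fract q * y = to_fract a" by blast
  obtain a b where x: "x = Fract a b" "b \<noteq> 0" by (cases x) auto
  have "to_fract (q * b) * x = to_fract (q * a)"
    using x by (simp add: Fract_conv_to_fract)
  moreover have "\<exists>a. to_fract (q * b) * y = to_fract a" if "y \<in> S" for y
  proof -
    obtain a where "to_fract q * y = to_fract a" using q(2)[OF \<open>y \<in> S\<close>] by blast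
    hence "to_fract (q * b) * y = to_fract (b * a)" by (simp add: mult_ac)
    thus ?thesis by blast
  qed
  ultimately have "\<forall>y\<in>insert x S. \<exists>a. to_fract (q * b) * y = to_fract a" by blast
  thus ?case using q(1) x(2) by (intro exI[of _ "q * b"] conjI) auto
qed

lemma common_denominator_mat:
  fixes X :: "nat \<Rightarrow> nat \<Rightarrow> 'a :: idom fract"
  obtains q B where "q \<noteq> 0"
    "\<And>i k. i < m \<Longrightarrow> k < r \<Longrightarrow> to_fract q * X i k = to_fract (B i k)"
proof -
  let ?S = "(\<lambda>(i,k). X i k) ` ({..<m} \<times> {..<r})"
  have "finite ?S" by simp
  from common_denominator[OF this] obtain q
    where q: "q \<noteq> 0" "\<And>x. x \<in> ?S \<Longrightarrow> \<exists>a. to_fract q * x = to_fract a" by blast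
  have "\<exists>a. to_fract q * X i k = to_fract a" if "i < m" "k < r" for i k
    by (rule q(2), rule image_eqI[of _ _ "(i,k)"]) (use that in auto)
  hence "\<forall>i k. \<exists>a. i < m \<and> k < r \<longrightarrow> to_fract q * X i k = to_fract a" by blast
  then obtain B where "\<And>i k. i < m \<and> k < r \<longrightarrow> to_fract q * X i k = to_fract (B i k)" by metis
  with q(1) that show thesis by blast
qed

lemma normal_rank_le_iff:
  assumes "P \<in> carrier_mat m n"
  shows "normal_rank P \<le> r \<longleftrightarrow>
    (\<exists>X Y. \<forall>i<m. \<forall>j<n. to_fract (P $$ (i,j)) = (\<Sum>k<r. X i k * Y k j))"
proof -
  have P: "map_mat to_fract P \<in> carrier_mat m n" using assms by simp
  have dim: "dim_row P = m" using assms by simp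
  show ?thesis
  proof
    assume "normal_rank P \<le> r"
    then obtain X Y where "\<And>i j. i < m \<Longrightarrow> j < n \<Longrightarrow> map_mat to_fract P $$ (i,j) = (\<Sum>k<r. X i k * Y k j)"
      using vec_space.factorization_of_rank_le[OF P] unfolding normal_rank_def dim by blast
    thus "\<exists>X Y. \<forall>i<m. \<forall>j<n. to_fract (P $$ (i,j)) = (\<Sum>k<r. X i k * Y k j)"
      using assms by auto
  next
    assume "\<exists>X Y. \<forall>i<m. \<forall>j<n. to_fract (P $$ (i,j)) = (\<Sum>k<r. X i k * Y k j)"
    then obtain X Y where "\<forall>i<m. \<forall>j<n. to_fract (P $$ (i,j)) = (\<Sum>k<r. X i k * Y k j)" by blast
    thus "normal_rank P \<le> r" unfolding normal_rank_def dim
      using assms by (intro vec_space.rank_le_of_factorization[OF P, where X = X and Y = Y and r = r]) auto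
  qed
qed

text \<open>A rank factorization over the rational functions becomes a scaled polynomial
  factorization with scalar \<open>q1 * q2\<close>; passing to a minimal one removes the scalar and
  bounds the degrees.\<close>

lemma polymats_rank_bounded_products:
  assumes "P \<in> polymats_rank m n d r"
  obtains e where "\<And>k. k < r \<Longrightarrow> e k \<le> d" "P \<in> bounded_products m n r d e"
proof -
  have P: "P \<in> carrier_mat m n" and rank: "normal_rank P \<le> r"
    and deg: "\<And>i j. i < m \<Longrightarrow> j < n \<Longrightarrow> degree (P $$ (i,j)) \<le> d"
    using assms by (auto simp: polymats_rank_def polymats_def)
  from rank obtain X Y where XY: "\<And>i j. i < m \<Longrightarrow> j < n \<Longrightarrow> to_fract (P $$ (i,j)) = (\<Sum>k<r. X i k * Y k j)"
    unfolding normal_rank_le_iff[OF P] by blast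
  obtain q1 L where q1: "q1 \<noteq> 0"
    and L: "\<And>i k. i < m \<Longrightarrow> k < r \<Longrightarrow> to_fract q1 * X i k = to_fract (L i k)"
    by (rule common_denominator_mat[of m r X]) blast
  obtain q2 R where q2: "q2 \<noteq> 0"
    and R: "\<And>k j. k < r \<Longrightarrow> j < n \<Longrightarrow> to_fract q2 * Y k j = to_fract (R k j)"
    by (rule common_denominator_mat[of r n Y]) blast
  have to_fract_sum: "to_fract (sum h {..<N}) = (\<Sum>k<N. to_fract (h k))" for h :: "nat \<Rightarrow> complex poly" and N
    by (induction N) auto
  have PLR: "(q1 * q2) * P $$ (i,j) = (\<Sum>k<r. L i k * R k j)" if "i < m" "j < n" for i j
  proof -
    have "to_fract ((q1 * q2) * P $$ (i,j)) = (\<Sum>k<r. (to_fract q1 * X i k) * (to_fract q2 * Y k j))"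
      unfolding to_fract_mult XY[OF that] sum_distrib_left by (rule sum.cong) (auto simp: mult_ac)
    also have "\<dots> = to_fract (\<Sum>k<r. L i k * R k j)"
      unfolding to_fract_sum by (rule sum.cong) (use L R that in auto)
    finally show ?thesis unfolding to_fract_eq_iff .
  qed
  have nz: "q1 * q2 \<noteq> 0" using q1 q2 by simp
  have root: "\<exists>x. poly p x = 0" if "degree p > 0" for p :: "complex poly"
    using fundamental_theorem_of_algebra[of p] that by (simp add: constant_degree)
  obtain u v e where uv: "\<And>k. k < r \<Longrightarrow> e k \<le> d"
    "\<And>i k. i < m \<Longrightarrow> k < r \<Longrightarrow> degree (u i k) + e k \<le> d"
    "\<And>k j. k < r \<Longrightarrow> j < n \<Longrightarrow> degree (v k j) \<le> e k"
    "\<And>i j. i < m \<Longrightarrow> j < n \<Longrightarrow> P $$ (i,j) = (\<Sum>k<r. u i k * v k j)"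
    by (rule factorization_with_degrees[OF root nz PLR deg]) blast+
  have "P \<in> bounded_products m n r d e"
    unfolding bounded_products_def mem_Collect_eq
    by (intro conjI exI[of _ u] exI[of _ v]) (use uv P in simp_all)
  with uv(1) that show thesis by blast
qed

text \<open>Vanishing of all minors of order \<open>r + 1\<close> is a closed condition, and over
  the fraction field it is equivalent to a factorization through dimension \<open>r\<close>.\<close>

lemma pclosure_low_rank:
  assumes X: "\<And>Q. Q \<in> X \<Longrightarrow> \<exists>u v. \<forall>i<m. \<forall>j<n. Q $$ (i,j) = (\<Sum>k<r. u i k * v k j)"
  shows "pclosure m n d X \<subseteq> polymats_rank m n d r"
proof
  fix P assume P: "P \<in> pclosure m n d X"
  hence Pd: "P \<in> polymats m n d" by (simp add: pclosure_def)
  hence Pc: "P \<in> carrier_mat m n" by (simp add: polymats_def)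
  from P obtain Q where Q: "\<And>t::nat. Q t \<in> X \<inter> polymats m n d"
    and lim: "\<And>i j k. i < m \<Longrightarrow> j < n \<Longrightarrow> k \<le> d \<Longrightarrow>
      (\<lambda>t. coeff (Q t $$ (i,j)) k) \<longlonglongrightarrow> coeff (P $$ (i,j)) k"
    by (rule pclosureE) blast
  have minor_0: "Determinant.det (Matrix.mat (Suc r) (Suc r) (\<lambda>(k,l). P $$ (f k, g l))) = 0"
    if fg: "\<forall>k<Suc r. f k < m \<and> g k < n" for f g
  proof -
    \<comment> \<open>Evaluation at \<open>x\<close> reduces to complex determinants, where limits
      are available; a polynomial vanishing at every complex \<open>x\<close> is 0.\<close>
    define M where "M T x = Matrix.mat (Suc r) (Suc r) (\<lambda>(k,l). poly (T $$ (f k, g l)) x)" for T :: "complex poly mat" and x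
    have eval: "poly (Determinant.det (Matrix.mat (Suc r) (Suc r) (\<lambda>(k,l). T $$ (f k, g l)))) x =
        Determinant.det (M T x)" for T x
    proof -
      interpret comm_ring_hom "\<lambda>p. poly p x" by unfold_locales auto
      have "map_mat (\<lambda>p. poly p x) (Matrix.mat (Suc r) (Suc r) (\<lambda>(k,l). T $$ (f k, g l))) = M T x"
        by (rule eq_matI) (auto simp: M_def)
      thus ?thesis by (metis hom_det)
    qed
    have "Determinant.det (M P x) = 0" for x
    proof -
      have "Determinant.det (M (Q t) x) = 0" for t
      proof -
        obtain u v where uv: "\<forall>i<m. \<forall>j<n. Q t $$ (i,j) = (\<Sum>k<r. u i k * v k j)" using X Q by blast
        have "M (Q t) x = Matrix.mat (Suc r) (Suc r) (\<lambda>(k,l). \<Sum>s<r. poly (u (f k) s) x * poly (v s (g l)) x)"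
          by (rule eq_matI) (use uv fg in \<open>auto simp: M_def poly_sum\<close>)
        thus ?thesis by (simp only: det_low_inner_dimension)
      qed
      moreover have "(\<lambda>t. Determinant.det (M (Q t) x)) \<longlonglongrightarrow> Determinant.det (M P x)"
      proof -
        \<comment> \<open>The common degree bound \<open>d\<close> makes evaluation a sum over a
          fixed index range, so coefficientwise limits suffice.\<close>
        have poly_eq: "poly p x = (\<Sum>k\<le>d. coeff p k * x ^ k)" if "degree p \<le> d" for p :: "complex poly"
          unfolding poly_altdef using that
          by (intro sum.mono_neutral_left) (auto simp: coeff_eq_0)
        have entry: "(\<lambda>t. poly (Q t $$ (i,j)) x) \<longlonglongrightarrow> poly (P $$ (i,j)) x" if "i < m" "j < n" for i j
        proof -
          have "degree (Q t $$ (i,j)) \<le> d" "degree (P $$ (i,j)) \<le> d" for t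
            using Q[of t] Pd that by (auto simp: polymats_def)
          thus ?thesis using lim[OF that] by (simp only: poly_eq) (intro tendsto_intros, auto)
        qed
        have "(\<lambda>t. M (Q t) x $$ (k,l)) \<longlonglongrightarrow> M P x $$ (k,l)" if "k < Suc r" "l < Suc r" for k l
          using that fg by (simp add: M_def entry)
        moreover have "M T x \<in> carrier_mat (Suc r) (Suc r)" for T by (simp add: M_def)
        ultimately show ?thesis
          by (subst (1 2) det_def'[of _ "Suc r"])
            (auto intro!: tendsto_sum tendsto_mult tendsto_prod dest: permutes_in_image)
      qed
      ultimately show ?thesis by (simp add: LIMSEQ_const_iff)
    qed
    thus ?thesis using eval[of P] by (metis poly_all_0_iff_0)
  qed
  interpret to_fract: comm_ring_hom "to_fract :: complex poly \<Rightarrow> _" by unfold_locales auto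
  have "Determinant.det (Matrix.mat (Suc r) (Suc r) (\<lambda>(k,l). to_fract (P $$ (f k, g l)))) = 0"
    if fg: "\<forall>k<Suc r. f k < m \<and> g k < n" for f g
  proof -
    have "Matrix.mat (Suc r) (Suc r) (\<lambda>(k,l). to_fract (P $$ (f k, g l))) =
        map_mat to_fract (Matrix.mat (Suc r) (Suc r) (\<lambda>(k,l). P $$ (f k, g l)))"
      by (rule eq_matI) auto
    thus ?thesis using minor_0[OF fg] by (metis to_fract.hom_det to_fract_0)
  qed
  hence "normal_rank P \<le> r"
    unfolding normal_rank_le_iff[OF Pc]
    using factorization_or_minor[of m n "\<lambda>i j. to_fract (P $$ (i,j))" r] by blast
  with Pd show "P \<in> polymats_rank m n d r" by (simp add: polymats_rank_def)
qed

theorem theorem4p8: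
  fixes m n r d :: nat
  assumes "m \<ge> 2" and "n \<ge> 2" and "d \<ge> 1" and "0 < r" and "r < min m n"
  shows "(\<forall>a. a \<le> r * d \<longrightarrow> setB m n r d a \<subseteq> setA m n r d a)
       \<and> (\<forall>a. a \<le> r * d \<longrightarrow> pclosure m n d (setB m n r d a) = pclosure m n d (setA m n r d a))
       \<and> polymats_rank m n d r = (\<Union>a\<in>{0..r * d}. pclosure m n d (setB m n r d a))
       \<and> (\<forall>P\<in>polymats_rank m n d r. \<exists>a::nat. P \<in> pclosure m n d (setB m n r d a))"
proof -
  have pos: "m > 0" "n > 0" using assms by auto
  have "polymats_rank m n d r \<subseteq> (\<Union>a\<in>{0..r * d}. pclosure m n d (setB m n r d a))"
  proof
    fix P assume "P \<in> polymats_rank m n d r"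
    then obtain e where e: "\<And>k. k < r \<Longrightarrow> e k \<le> d" "P \<in> bounded_products m n r d e"
      by (rule polymats_rank_bounded_products) blast
    \<comment> \<open>The degrees found in the factorization select the index \<open>a\<close> as
      their sum.\<close>
    have "(\<Sum>k<r. e k) \<le> r * d" using sum_bounded_above[of "{..<r}" e d] e(1) by simp
    moreover from this have "P \<in> pclosure m n d (setB m n r d (\<Sum>k<r. e k))"
      using bounded_products_subset_pclosure_setB[OF pos assms(4) refl] e(2) by blast
    ultimately show "P \<in> (\<Union>a\<in>{0..r * d}. pclosure m n d (setB m n r d a))" by auto
  qed
  moreover have "pclosure m n d (setB m n r d a) \<subseteq> polymats_rank m n d r" if "a \<le> r * d" for a
  proof (rule pclosure_low_rank)
    fix Q assume "Q \<in> setB m n r d a"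
    hence "Q \<in> bounded_products m n r d (balanced r a)"
      unfolding setB_eq_degree_products[OF assms(4) that]
      using degree_products_subset_bounded_products by blast
    thus "\<exists>u v. \<forall>i<m. \<forall>j<n. Q $$ (i,j) = (\<Sum>k<r. u i k * v k j)"
      by (rule bounded_productsE) blast
  qed
  ultimately have eq: "polymats_rank m n d r = (\<Union>a\<in>{0..r * d}. pclosure m n d (setB m n r d a))"
    by (intro subset_antisym UN_least) simp_all
  show ?thesis
  proof (intro conjI allI impI ballI eq)
    show "\<exists>a. P \<in> pclosure m n d (setB m n r d a)" if "P \<in> polymats_rank m n d r" for P
      using that unfolding eq by blast
  qed (use setB_subset_setA[OF assms(4)] pclosure_setA_eq_setB[OF pos assms(4)] in simp_all)
qed

end
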